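(* Let $\mathcal{H}$ be a complex Hilbert space, let $\{P_n\}_{n\in\mathbb{Z}}$ and $\{Q_n\}_{n\in\mathbb{Z}}$ be block decompositions of $\mathcal{H}$, and let $T\in\mathcal{K}(\mathcal{H})$ be a compact operator. For $k\in\mathbb{Z}$ let $$T_k:=\sum_{n\in\mathbb{Z}}Q_nTP_{n+k}$$ (convergence in the strong operator topology), so that $\{T_k\}_{k\in\mathbb{Z}}$ is the asymmetric shift decomposition of $T$. Then for every $k\in\mathbb{Z}$ the singular value sequence of $T_k$ is submajorized by that of $T$, $s(T_k)\prec\!\prec s(T)$; that is, $$\sum_{n=1}^{m}s_n(T_k)\le\sum_{n=1}^{m}s_n(T)\qquad\text{for all } m\in\mathbb{N}.$$ Consequently, if $T$ lies in an ideal $\mathcal{I}$ of $\mathcal{B}(\mathcal{H})$, then $T_k$ lies in the arithmetic mean closure $\overline{\mathcal{I}}^{\,am}$ of $\mathcal{I}$ for every $k\in\mathbb{Z}$.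
   Context: $\mathcal{B}(\mathcal{H})$ and $\mathcal{K}(\mathcal{H})$ denote the bounded and the compact linear operators on $\mathcal{H}$. "Projection" means orthogonal projection. A block decomposition is a sequence $\{P_n\}_{n\in\mathbb{Z}}$ of mutually orthogonal projections in $\mathcal{B}(\mathcal{H})$ (some of which may be zero) with $\sum_{n\in\mathbb{Z}}P_n=I$ (in the strong operator topology). The two block decompositions $\{P_n\}$ and $\{Q_n\}$ need not be related to each other. For any two sequences of mutually orthogonal projections and any bounded $T$, the series $\sum_{n\in\mathbb{Z}}Q_nTP_{n+k}$ converges in the strong operator topology, and if $T$ is compact then so is the sum. For compact $A$, $s(A)=(s_n(A))_{n\in\mathbb{N}}$ ($\mathbb{N}=\{1,2,\dots\}$) is the singular value sequence of $A$: the nonzero eigenvalues of $|A|=(A^*A)^{1/2}$ in nonincreasing order repeated according to multiplicity, followed by zeros if there are only finitely many. It belongs to $c_0^*$, the convex cone of nonnegative nonincreasing sequences indexed by $\mathbb{N}$ converging to zero. For $(a_n),(b_n)\in c_0^*$, $(a_n)$ is submajorized by $(b_n)$, written $(a_n)\prec\!\prec(b_n)$, if $\sum_{n=1}^m a_n\le\sum_{n=1}^m b_n$ for all $m\in\mathbb{N}$. An ideal means a two-sided ideal of $\mathcal{B}(\mathcal{H})$ (not necessarily norm closed). The arithmetic mean closure $\overline{\mathcal{I}}^{\,am}$ of an ideal $\mathcal{I}$ is the ideal of those compact operators $A$ whose singular value sequence lies in the hereditary closure, with respect to submajorization, of the set of singular value sequences of compact operators in $\mathcal{I}$: $$\overline{\mathcal{I}}^{\,am}=\{A\in\mathcal{K}(\mathcal{H})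 : \text{there is a compact } B\in\mathcal{I}\text{ with } s(A)\prec\!\prec s(B)\}.$$ *)

theory Defs
  imports "HOL-Analysis.Analysis"
begin

section \<open>Complex Hilbert spaces\<close>

class complex_vector = real_vector +
  fixes scaleC :: "complex \<Rightarrow> 'a \<Rightarrow> 'a"  (infixr \<open>*\<^sub>C\<close> 75)
  assumes scaleC_add_right: "c *\<^sub>C (x + y) = c *\<^sub>C x + c *\<^sub>C y"
    and scaleC_add_left: "(c + d) *\<^sub>C x = c *\<^sub>C x + d *\<^sub>C x"
    and scaleC_scaleC: "c *\<^sub>C d *\<^sub>C x = (c * d) *\<^sub>C x"
    and scaleC_one: "1 *\<^sub>C x = x"
    and scaleC_of_real: "complex_of_real r *\<^sub>C x = r *\<^sub>R x"

global_interpretation complex_vector: vector_space "scaleC :: complex \<Rightarrow> 'a \<Rightarrow> 'a::complex_vector"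
  by unfold_locales
    (simp_all add: scaleC_add_right scaleC_add_left scaleC_scaleC scaleC_one)

text \<open>
  The underlying real inner product is the real part of the complex one. Since
  \<open>real_inner\<close> gives \<open>norm x = sqrt (inner x x)\<close>, the norm and the topology are those
  induced by \<open>cinner\<close>, and \<open>cinner\<close> is positive definite. It is linear in its first argument.
\<close>

class complex_inner = complex_vector + real_inner +
  fixes cinner :: "'a \<Rightarrow> 'a \<Rightarrow> complex"
  assumes cinner_commute: "cinner x y = cnj (cinner y x)"
    and cinner_add_left: "cinner (x + y) z = cinner x z + cinner y z"
    and cinner_scaleC_left: "cinner (c *\<^sub>C x) y = c * cinner x y"
    and Re_cinner: "Re (cinner x y) = inner x y"

class chilbert_space = complex_inner + complete_space

instantiation complex :: chilbert_space
begin

definition "scaleC_complex = ((*) :: complex \<Rightarrow> complex \<Rightarrow> complex)"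
definition "cinner_complex = (\<lambda>x y :: complex. x * cnj y)"

instance
  by standard
    (simp_all add: scaleC_complex_def cinner_complex_def algebra_simps inner_complex_def
      scaleR_conv_of_real)

end


section \<open>Operators\<close>

definition bounded_clinear :: "('a::complex_inner \<Rightarrow> 'a) \<Rightarrow> bool" where
  "bounded_clinear A \<longleftrightarrow> bounded_linear A \<and> (\<forall>c x. A (c *\<^sub>C x) = c *\<^sub>C A x)"

definition compact_operator :: "('a::complex_inner \<Rightarrow> 'a) \<Rightarrow> bool" where
  "compact_operator A \<longleftrightarrow> bounded_clinear A \<and> compact (closure (A ` cball 0 1))"

definition orthogonal_projection :: "('a::complex_inner \<Rightarrow> 'a) \<Rightarrow> bool" where
  "orthogonal_projection P \<longleftrightarrow>
     bounded_clinear P \<and> P \<circ> P = P \<and> (\<forall>x y. cinner (P x) y = cinner x (P y))"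

definition block_decomposition :: "(int \<Rightarrow> 'a::complex_inner \<Rightarrow> 'a) \<Rightarrow> bool" where
  "block_decomposition P \<longleftrightarrow>
     (\<forall>n. orthogonal_projection (P n)) \<and>
     (\<forall>m n. m \<noteq> n \<longrightarrow> P m \<circ> P n = (\<lambda>x. 0)) \<and>
     (\<forall>x. ((\<lambda>n. P n x) has_sum x) UNIV)"

text \<open>
  The sum is taken pointwise, i.e.\ in the strong operator topology. \<open>infsum\<close> is \<open>0\<close> where the
  family is not summable, so summability has to be asserted separately.
\<close>

definition asymmetric_shift ::
  "(int \<Rightarrow> 'a::complex_inner \<Rightarrow> 'a) \<Rightarrow> (int \<Rightarrow> 'a \<Rightarrow> 'a) \<Rightarrow> ('a \<Rightarrow> 'a) \<Rightarrow> int \<Rightarrow> 'a \<Rightarrow> 'a" where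
  "asymmetric_shift Q P T k = (\<lambda>x. \<Sum>\<^sub>\<infinity>n\<in>UNIV. Q n (T (P (n + k) x)))"


section \<open>Singular values\<close>

definition cadjoint :: "('a::complex_inner \<Rightarrow> 'a) \<Rightarrow> 'a \<Rightarrow> 'a" where
  "cadjoint A = (THE B. \<forall>x y. cinner (A x) y = cinner x (B y))"

definition positive_operator :: "('a::complex_inner \<Rightarrow> 'a) \<Rightarrow> bool" where
  "positive_operator R \<longleftrightarrow>
     bounded_clinear R \<and> (\<forall>x. cinner (R x) x \<in> \<real> \<and> 0 \<le> Re (cinner (R x) x))"

definition abs_operator :: "('a::complex_inner \<Rightarrow> 'a) \<Rightarrow> 'a \<Rightarrow> 'a" where
  "abs_operator A = (THE R. positive_operator R \<and> R \<circ> R = cadjoint A \<circ> A)"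

definition eigenspace :: "('a::complex_inner \<Rightarrow> 'a) \<Rightarrow> complex \<Rightarrow> 'a set" where
  "eigenspace A c = {x. A x = c *\<^sub>C x}"

definition c0_star :: "(nat \<Rightarrow> real) set" where
  "c0_star = {s. (\<forall>n. 0 \<le> s n) \<and> decseq s \<and> s \<longlonglongrightarrow> 0}"

text \<open>
  Sequences are indexed from \<open>0\<close>: \<open>singular_values A n\<close> is the \<open>(n+1)\<close>-st singular value.
  A sequence in \<open>c0_star\<close> is determined by how often it takes each positive value, so prescribing
  these numbers to be the (complex) dimensions of the eigenspaces of \<open>abs_operator A\<close> lists the
  nonzero eigenvalues in nonincreasing order with multiplicity, and pads with zeros exactly when
  there are only finitely many. Both \<open>card\<close> and \<open>dim\<close> are finite here: a null sequence takes a
  positive value finitely often, and for compact \<open>A\<close> these eigenspaces are finite-dimensional.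
\<close>

definition singular_values :: "('a::complex_inner \<Rightarrow> 'a) \<Rightarrow> nat \<Rightarrow> real" where
  "singular_values A = (THE s. s \<in> c0_star \<and>
     (\<forall>r>0. card {n. s n = r} =
        complex_vector.dim (eigenspace (abs_operator A) (complex_of_real r))))"

definition submajorized :: "(nat \<Rightarrow> real) \<Rightarrow> (nat \<Rightarrow> real) \<Rightarrow> bool"  (infix \<open>\<prec>\<prec>\<close> 50) where
  "a \<prec>\<prec> b \<longleftrightarrow> (\<forall>m. (\<Sum>n<m. a n) \<le> (\<Sum>n<m. b n))"


section \<open>Operator ideals\<close>

text \<open>Closure under scalar multiples follows by composing with multiples of the identity.\<close>

definition operator_ideal :: "('a::complex_inner \<Rightarrow> 'a) set \<Rightarrow> bool" where
  "operator_ideal I \<longleftrightarrow>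
     I \<subseteq> Collect bounded_clinear \<and> (\<lambda>x. 0) \<in> I \<and>
     (\<forall>A\<in>I. \<forall>B\<in>I. (\<lambda>x. A x + B x) \<in> I) \<and>
     (\<forall>A\<in>I. \<forall>X. bounded_clinear X \<longrightarrow> X \<circ> A \<in> I \<and> A \<circ> X \<in> I)"

definition am_closure :: "('a::complex_inner \<Rightarrow> 'a) set \<Rightarrow> ('a \<Rightarrow> 'a) set" where
  "am_closure I = {A. compact_operator A \<and>
     (\<exists>B\<in>I. compact_operator B \<and> singular_values A \<prec>\<prec> singular_values B)}"

end

theory Submission
  imports Defs
begin

text \<open>
  Write $Tx = \sum_j s_j \langle x, e_j\rangle f_j$ for a Schmidt decomposition of $T$, and let $u_i$, $v_i$
  be the right and left singular vectors of $T_k$. Then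
  $\sum_{i<m} s_i(T_k) = \sum_{i<m} \sum_n \langle T P_{n+k} u_i, Q_n v_i\rangle \le \sum_j s_j c_j$
  with $c_j = \sum_{i<m} \sum_n |\langle P_{n+k} u_i, e_j\rangle| |\langle f_j, Q_n v_i\rangle|$.
  Bessel's inequality for $(u_i)$ and $(v_i)$ gives $c_j \le 1$, and for $(e_j)$ and $(f_j)$ it
  gives $\sum_j c_j \le m$; since $(s_j)$ decreases, the right-hand side is at most
  $\sum_{j<m} s_j$. The Schmidt decomposition is obtained by successively maximizing $\|Tx\|$ over
  unit vectors orthogonal to the earlier maximizers, and it yields the adjoint, $|T|$ and the
  eigenspaces of $|T|$ explicitly.
\<close>

section \<open>Orthogonal series and norm-attaining vectors\<close>

text \<open>\<open>cadjoint\<close>, \<open>abs_operator\<close> and \<open>singular_values\<close>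
  are definite descriptions, so nothing is known about them until existence and uniqueness are
  proved. All of this is drawn from one estimate on the Schmidt series: after \<open>J\<close> terms
  the remainder at \<open>x\<close> has norm at most the \<open>J\<close>-th singular value (counted
  from 0) times \<open>norm x\<close>. The shifted operator needs a Schmidt decomposition of its
  own, hence must first be shown compact, although its block series is only given as a strong limit.
  Compactness of \<open>T\<close> makes all but finitely many of the operators
  \<open>Q n \<circ> T\<close> uniformly small, and mutual orthogonality of the blocks turns this
  into norm approximation by finite block sums. In the final estimate no multiple series is
  rearranged. It is proved for a finite set of blocks and \<open>J\<close> Schmidt terms, with an
  explicit error that vanishes as \<open>J\<close> grows. The weights are sums of products, while
  Bessel's inequality bounds sums of squares; as all those bounds are matched in pairs,
  \<open>a * b \<le> (a\<^sup>2 + b\<^sup>2) / 2\<close> does the work of Cauchy-Schwarz.\<close>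

lemma summable_on_orthogonal:
  fixes f :: "'i \<Rightarrow> 'a::{real_inner, complete_space}"
  assumes orth: "pairwise (\<lambda>i j. orthogonal (f i) (f j)) A"
    and sq: "(\<lambda>i. (norm (f i))\<^sup>2) summable_on A"
  shows "f summable_on A"
proof -
  let ?h = "sum (\<lambda>i. (norm (f i))\<^sup>2)"
  obtain L where L: "(?h \<longlongrightarrow> L) (finite_subsets_at_top A)"
    using sq unfolding summable_on_def has_sum_def by blast
  have "\<exists>P. eventually P (finite_subsets_at_top A) \<and>
      (\<forall>F F'. P F \<and> P F' \<longrightarrow> dist (sum f F) (sum f F') < e)" if "e > 0" for e
  proof -
    \<comment> \<open>Partial sums of squares within \<open>d\<close> of \<open>L\<close> differ by
      less than \<open>2 * d = (e/2)\<^sup>2\<close>. By Pythagoras this controls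
      \<open>sum f\<close> for nested index sets; arbitrary ones are compared through their union,
      which costs the factor 2.\<close>
    define d where "d = (e/2)\<^sup>2 / 2"
    have d: "d > 0" using that by (simp add: d_def)
    have "eventually (\<lambda>F. dist (?h F) L < d) (finite_subsets_at_top A)"
      using L d by (rule tendstoD)
    then obtain F0 where F0: "finite F0" "F0 \<subseteq> A"
      and h0: "\<forall>F. finite F \<and> F0 \<subseteq> F \<and> F \<subseteq> A \<longrightarrow> dist (?h F) L < d"
      unfolding eventually_finite_subsets_at_top by (elim exE conjE)
    have h: "dist (?h F) L < d" if "finite F" "F0 \<subseteq> F" "F \<subseteq> A" for F
      using h0 that by simp
    let ?P = "\<lambda>F. finite F \<and> F0 \<subseteq> F \<and> F \<subseteq> A"
    have half: "norm (sum f F - sum f G) < e/2" if "?P F" "?P G" "G \<subseteq> F" for F G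
    proof -
      have "(norm (sum f F - sum f G))\<^sup>2 = (norm (sum f (F - G)))\<^sup>2"
        using that by (simp add: sum_diff)
      also have "\<dots> = ?h (F - G)"
        using that orth by (intro norm_sum_Pythagorean) (auto intro: pairwise_subset)
      also have "\<dots> = ?h F - ?h G" using that by (simp add: sum_diff)
      also have "\<dots> < (e/2)\<^sup>2"
        using h[of F] h[of G] that unfolding d_def dist_real_def by linarith
      finally show ?thesis by (rule power2_less_imp_less) (use \<open>e > 0\<close> in auto)
    qed
    have "\<forall>F G. ?P F \<and> ?P G \<longrightarrow> dist (sum f F) (sum f G) < e"
    proof (intro allI impI, elim conjE)
      fix F G assume that: "finite F" "F0 \<subseteq> F" "F \<subseteq> A" "finite G" "F0 \<subseteq> G" "G \<subseteq> A"
      have "dist (sum f (F \<union> G)) (sum f F) < e/2" "dist (sum f (F \<union> G)) (sum f G) < e/2"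
        using half[of "F \<union> G" F] half[of "F \<union> G" G] that by (auto simp: dist_norm)
      then show "dist (sum f F) (sum f G) < e" by (rule dist_triangle_half_r)
    qed
    moreover have "eventually ?P (finite_subsets_at_top A)"
      unfolding eventually_finite_subsets_at_top by (rule exI[of _ F0], intro conjI allI impI) (use F0 in auto)
    ultimately show ?thesis by (intro exI[of _ ?P] conjI)
  qed
  then have "cauchy_filter (filtermap (sum f) (finite_subsets_at_top A))"
    by (simp add: cauchy_filter_metric_filtermap)
  moreover have "complete (UNIV::'a set)"
    by (rule complete_UNIV)
  ultimately obtain L' where "(sum f \<longlongrightarrow> L') (finite_subsets_at_top A)"
    using complete_uniform[where S=UNIV] by (force simp add: filterlim_def)
  then show ?thesis
    using summable_on_def has_sum_def by blast
qed

lemma has_sum_norm_le: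
  assumes "(f has_sum S) A" and "\<And>F. finite F \<Longrightarrow> F \<subseteq> A \<Longrightarrow> norm (sum f F) \<le> B"
  shows "norm S \<le> B"
proof -
  have "((\<lambda>F. norm (sum f F)) \<longlongrightarrow> norm S) (finite_subsets_at_top A)"
    using assms(1) unfolding has_sum_def by (rule tendsto_norm)
  then show ?thesis
    using assms(2) by (rule tendsto_upperbound[OF _ eventually_finite_subsets_at_top_weakI]) simp_all
qed

text \<open>Bounds on finite sums of squares are what Bessel's inequality supplies, for diagonal
  series as well as for block sums; \<open>B\<close> becomes the operator bound there.\<close>

lemma
  fixes f :: "'i \<Rightarrow> 'a::{real_inner, complete_space}"
  assumes orth: "pairwise (\<lambda>i j. orthogonal (f i) (f j)) A"
    and le: "\<And>F. finite F \<Longrightarrow> F \<subseteq> A \<Longrightarrow> (\<Sum>i\<in>F. (norm (f i))\<^sup>2) \<le> B\<^sup>2" and B: "0 \<le> B"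
  shows summable_on_orthogonal_bounded: "f summable_on A"
    and norm_infsum_orthogonal_le: "norm (infsum f A) \<le> B"
proof -
  have "(\<lambda>i. (norm (f i))\<^sup>2) summable_on A"
    using le by (intro nonneg_bdd_above_summable_on) (auto intro!: bdd_aboveI)
  then show s: "f summable_on A" by (rule summable_on_orthogonal[OF orth])
  show "norm (infsum f A) \<le> B"
  proof (rule has_sum_norm_le[OF has_sum_infsum[OF s]])
    fix F assume F: "finite F" "F \<subseteq> A"
    have "(norm (sum f F))\<^sup>2 = (\<Sum>i\<in>F. (norm (f i))\<^sup>2)"
      using F orth by (intro norm_sum_Pythagorean) (auto intro: pairwise_subset)
    with le[OF F] show "norm (sum f F) \<le> B" by (intro power2_le_imp_le[OF _ B]) simp
  qed
qed

lemma compact_convergent_subsequence: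
  fixes f :: "nat \<Rightarrow> 'a::metric_space"
  assumes "compact S" "\<And>n. f n \<in> S"
  obtains l \<phi> where "strict_mono \<phi>" "(\<lambda>n. f (\<phi> n)) \<longlonglongrightarrow> l"
proof -
  have "\<forall>n. f n \<in> S" using assms(2) by simp
  from seq_compactE[OF compact_imp_seq_compact[OF assms(1)] this]
  show thesis using that unfolding o_def by blast
qed

text \<open>
  By the parallelogram law, a maximizing sequence whose images converge is itself Cauchy, so
  neither adjoints nor weak compactness are needed.
\<close>

lemma compact_linear_norm_attained:
  fixes A :: "'a::{real_inner, complete_space} \<Rightarrow> 'b::real_normed_vector"
  assumes A: "bounded_linear A" and cpt: "compact (closure (A ` cball 0 1))"
    and V: "closed V" "subspace V"
  shows "\<exists>r\<in>V. (r = 0 \<or> norm r = 1) \<and> (\<forall>x\<in>V. norm (A x) \<le> norm (A r) * norm x)"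
proof -
  interpret A: bounded_linear A by fact
  define U where "U = V \<inter> cball 0 1"
  define N where "N = (SUP x\<in>U. norm (A x))"
  have U0: "0 \<in> U" using V by (simp add: U_def subspace_0)
  have "bounded (A ` U)"
  proof (rule bounded_subset[OF compact_imp_bounded[OF cpt]])
    show "A ` U \<subseteq> closure (A ` cball 0 1)"
      using closure_subset[of "A ` cball 0 1"] by (auto simp: U_def)
  qed
  then obtain K where "\<And>x. x \<in> U \<Longrightarrow> norm (A x) \<le> K"
    unfolding bounded_iff by auto
  then have bdd: "bdd_above ((\<lambda>x. norm (A x)) ` U)"
    by (intro bdd_aboveI[of _ K]) blast
  have leN: "norm (A x) \<le> N * norm x" if "x \<in> V" for x
  proof (cases "x = 0")
    case False
    then have "(1 / norm x) *\<^sub>R x \<in> U" using V that by (simp add: U_def subspace_scale)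
    then have "norm (A ((1 / norm x) *\<^sub>R x)) \<le> N" unfolding N_def by (rule cSUP_upper[OF _ bdd])
    then show ?thesis using False by (simp add: A.scaleR field_simps)
  qed (simp add: A.zero)
  have N0: "0 \<le> N" using cSUP_upper[OF U0 bdd] by (simp add: N_def A.zero)
  show ?thesis
  proof (cases "N = 0")
    case True
    \<comment> \<open>Here \<open>A\<close> vanishes on \<open>V\<close>, which may contain no unit
      vector at all; this is the source of the alternative \<open>r = 0\<close>.\<close>
    then show ?thesis using leN V by (intro bexI[of _ 0]) (auto simp: A.zero subspace_0)
  next
    case False
    with N0 have N: "N > 0" by simp
    have "\<exists>x\<in>U. N - inverse (real (Suc n)) < norm (A x)" for n
      using less_cSUP_iff[of U "\<lambda>x. norm (A x)" "N - inverse (real (Suc n))", OF _ bdd] U0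
      by (auto simp flip: N_def)
    then obtain x where xU: "\<And>n. x n \<in> U" and xN: "\<And>n. N - inverse (real (Suc n)) < norm (A (x n))"
      by metis
    have "A (x n) \<in> closure (A ` cball 0 1)" for n
      using xU by (intro subsetD[OF closure_subset] imageI) (simp add: U_def)
    then obtain y \<phi> where \<phi>: "strict_mono \<phi>" and y: "(\<lambda>n. A (x (\<phi> n))) \<longlonglongrightarrow> y"
      by (rule compact_convergent_subsequence[OF cpt])
    have xV: "x n \<in> V" and x1: "norm (x n) \<le> 1" for n using xU by (auto simp: U_def)
    have "(\<lambda>n. norm (A (x (\<phi> n)))) \<longlonglongrightarrow> N"
    proof (rule tendsto_sandwich)
      show "\<forall>\<^sub>F n in sequentially. N - inverse (real (Suc n)) \<le> norm (A (x (\<phi> n)))"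
      proof (rule always_eventually, rule allI)
        fix n
        have "inverse (real (Suc (\<phi> n))) \<le> inverse (real (Suc n))"
          using seq_suble[OF \<phi>, of n] by (intro le_imp_inverse_le) auto
        then show "N - inverse (real (Suc n)) \<le> norm (A (x (\<phi> n)))" using xN[of "\<phi> n"] by linarith
      qed
      show "\<forall>\<^sub>F n in sequentially. norm (A (x (\<phi> n))) \<le> N"
        using cSUP_upper[OF xU bdd] by (auto simp: N_def)
      show "(\<lambda>n. N - inverse (real (Suc n))) \<longlonglongrightarrow> N"
        using tendsto_diff[OF tendsto_const LIMSEQ_inverse_real_of_nat, of N] by simp
    qed simp
    then have yN: "norm y = N" using y tendsto_norm LIMSEQ_unique by blast
    define a where "a n = norm (A (x (\<phi> n)) - y)" for n
    have a0: "a \<longlonglongrightarrow> 0" unfolding a_def using y by (simp add: LIM_zero_iff tendsto_norm_zero)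
    \<comment> \<open>Both images are close to \<open>y\<close>, of norm \<open>N\<close>, so
      \<open>A (?u + ?v)\<close> has norm close to \<open>2 * N\<close> and \<open>?u + ?v\<close>
      has norm close to 2. Within the unit ball the parallelogram law then forces
      \<open>?u - ?v\<close> to be small.\<close>
    have par: "(norm (x (\<phi> i) - x (\<phi> j)))\<^sup>2 \<le> 4 * (a i + a j) / N" for i j
    proof -
      let ?u = "x (\<phi> i)" and ?v = "x (\<phi> j)"
      define b where "b = (a i + a j) / N"
      have "2 * N = norm (2 *\<^sub>R y)" using yN by simp
      also have "2 *\<^sub>R y = A (?u + ?v) - ((A ?u - y) + (A ?v - y))"
        by (simp add: A.add scaleR_2)
      also have "norm \<dots> \<le> norm (A (?u + ?v)) + (a i + a j)"
        unfolding a_def by (meson norm_triangle_ineq norm_triangle_ineq4 add_left_mono order_trans)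
      also have "norm (A (?u + ?v)) \<le> N * norm (?u + ?v)"
        using xV V by (intro leN subspace_add)
      finally have *: "2 - b \<le> norm (?u + ?v)"
        using N by (simp add: b_def field_simps)
      \<comment> \<open>The lower bound \<open>2 - b\<close> can be squared only while it is
        nonnegative; beyond that the left-hand side is negative anyway.\<close>
      have "4 - 4 * b \<le> (norm (?u + ?v))\<^sup>2"
      proof (cases "b \<le> 2")
        case True
        then have "(2 - b)\<^sup>2 \<le> (norm (?u + ?v))\<^sup>2" using * by (intro power_mono) auto
        moreover have "(2 - b)\<^sup>2 = 4 - 4 * b + b\<^sup>2" by (simp add: power2_eq_square algebra_simps)
        ultimately show ?thesis using zero_le_power2[of b] by linarith
      next
        case False
        then show ?thesis using zero_le_power2[of "norm (?u + ?v)"] by linarith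
      qed
      moreover have "(norm (?u - ?v))\<^sup>2 = 2 * (norm ?u)\<^sup>2 + 2 * (norm ?v)\<^sup>2 - (norm (?u + ?v))\<^sup>2"
        by (simp add: power2_norm_eq_inner algebra_simps inner_commute)
      moreover have "(norm ?u)\<^sup>2 \<le> 1" "(norm ?v)\<^sup>2 \<le> 1"
        using x1 by (simp_all add: power_le_one)
      ultimately show ?thesis by (simp add: b_def)
    qed
    have "Cauchy (\<lambda>n. x (\<phi> n))"
    proof (rule metric_CauchyI)
      fix e :: real assume e: "e > 0"
      \<comment> \<open>Chosen so that \<open>4 * (d + d) / N = e\<^sup>2\<close> in
        \<open>par\<close>.\<close>
      define d where "d = e\<^sup>2 * N / 8"
      have "d > 0" using e N by (simp add: d_def)
      then obtain M where M: "\<And>n. n \<ge> M \<Longrightarrow> a n < d"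
        using order_tendstoD(2)[OF a0] unfolding eventually_sequentially by blast
      have "dist (x (\<phi> m)) (x (\<phi> n)) < e" if "m \<ge> M" "n \<ge> M" for m n
      proof -
        have "4 * (a m + a n) / N < e\<^sup>2"
          using M[OF that(1)] M[OF that(2)] N unfolding d_def by (simp add: field_simps)
        then have "(norm (x (\<phi> m) - x (\<phi> n)))\<^sup>2 < e\<^sup>2" using par[of m n] by linarith
        then show ?thesis unfolding dist_norm by (rule power2_less_imp_less) (use e in auto)
      qed
      then show "\<exists>M. \<forall>m\<ge>M. \<forall>n\<ge>M. dist (x (\<phi> m)) (x (\<phi> n)) < e" by blast
    qed
    then obtain r where r: "(\<lambda>n. x (\<phi> n)) \<longlonglongrightarrow> r"
      using Cauchy_convergent convergent_def by blast
    have rV: "r \<in> V" using closed_sequentially[OF V(1) _ r] xV by blast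
    have r1: "norm r \<le> 1" using tendsto_norm[OF r] x1 by (intro LIMSEQ_le_const2) auto
    have "A r = y" using A.tendsto[OF r] y LIMSEQ_unique by blast
    then have Ar: "norm (A r) = N" using yN by simp
    then have "N \<le> N * norm r" using leN[OF rV] by simp
    then have "norm r = 1" using N r1 by simp
    then show ?thesis using rV leN Ar by auto
  qed
qed

section \<open>Complex inner products\<close>

lemma cinner_add_right: "cinner x (y + z) = cinner x y + cinner x z" for x :: "'a::complex_inner"
  by (metis cinner_add_left cinner_commute complex_cnj_add)

lemma cinner_scaleC_right: "cinner x (c *\<^sub>C y) = cnj c * cinner x y" for x :: "'a::complex_inner"
  by (metis cinner_commute cinner_scaleC_left complex_cnj_mult)

lemma cinner_scaleR_left: "cinner (r *\<^sub>R x) y = r *\<^sub>R cinner x y" for x :: "'a::complex_inner"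
  by (metis cinner_scaleC_left scaleC_of_real scaleR_conv_of_real)

lemma cinner_scaleR_right: "cinner x (r *\<^sub>R y) = r *\<^sub>R cinner x y" for x :: "'a::complex_inner"
  by (metis cinner_scaleC_right complex_cnj_complex_of_real scaleC_of_real scaleR_conv_of_real)

lemma cinner_self: "cinner x x = complex_of_real ((norm x)\<^sup>2)" for x :: "'a::complex_inner"
proof -
  have "Im (cinner x x) = 0"
    using arg_cong[OF cinner_commute[of x x], of Im] by simp
  then show ?thesis
    by (simp add: complex_eq_iff Re_cinner power2_norm_eq_inner)
qed

lemma norm_scaleC: "norm (c *\<^sub>C x) = cmod c * norm x" for x :: "'a::complex_inner"
proof -
  have "complex_of_real ((norm (c *\<^sub>C x))\<^sup>2) = c * cnj c * cinner x x"
    by (simp add: cinner_scaleC_left cinner_scaleC_right mult_ac flip: cinner_self del: of_real_power)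
  also have "\<dots> = complex_of_real ((cmod c * norm x)\<^sup>2)"
    by (simp add: cinner_self power_mult_distrib flip: complex_norm_square)
  finally have "(norm (c *\<^sub>C x))\<^sup>2 = (cmod c * norm x)\<^sup>2"
    using of_real_eq_iff by blast
  then show ?thesis by simp
qed

text \<open>Multiplying \<open>x\<close> by the conjugate of \<open>cinner x y\<close> makes the
  inner product real, equal to its squared modulus, so the real Cauchy-Schwarz inequality
  applies.\<close>

lemma norm_cinner_le: "cmod (cinner x y) \<le> norm x * norm y" for x :: "'a::complex_inner"
proof (cases "cinner x y = 0")
  case False
  let ?c = "cinner x y"
  have "(cmod ?c)\<^sup>2 = Re (cinner (cnj ?c *\<^sub>C x) y)"
    by (simp add: cinner_scaleC_left cmod_power2 flip: power2_eq_square)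
  also have "\<dots> \<le> norm (cnj ?c *\<^sub>C x) * norm y"
    unfolding Re_cinner by (rule norm_cauchy_schwarz)
  also have "\<dots> = cmod ?c * (norm x * norm y)" by (simp add: norm_scaleC)
  finally show ?thesis using False by (simp add: power2_eq_square)
qed simp

lemma bounded_linear_cinner_left: "bounded_linear (\<lambda>x. cinner x y)" for y :: "'a::complex_inner"
  by (rule bounded_linear_intro[of _ "norm y"])
    (simp_all add: cinner_add_left cinner_scaleR_left norm_cinner_le)

lemma bounded_linear_cinner_right: "bounded_linear (cinner x)" for x :: "'a::complex_inner"
  by (rule bounded_linear_intro[of _ "norm x"])
    (use norm_cinner_le[of x] in \<open>simp_all add: cinner_add_right cinner_scaleR_right mult.commute\<close>)

lemmas cinner_zero_left [simp] = linear_0[OF bounded_linear.linear[OF bounded_linear_cinner_left]]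
  and cinner_zero_right [simp] = linear_0[OF bounded_linear.linear[OF bounded_linear_cinner_right]]
  and cinner_diff_left = linear_diff[OF bounded_linear.linear[OF bounded_linear_cinner_left]]
  and cinner_diff_right = linear_diff[OF bounded_linear.linear[OF bounded_linear_cinner_right]]
  and cinner_sum_left = linear_sum[OF bounded_linear.linear[OF bounded_linear_cinner_left]]
  and cinner_sum_right = linear_sum[OF bounded_linear.linear[OF bounded_linear_cinner_right]]

lemma bounded_linear_scaleC_right: "bounded_linear (\<lambda>x::'a::complex_inner. c *\<^sub>C x)"
proof (rule bounded_linear_intro[of _ "cmod c"])
  show "c *\<^sub>C (r *\<^sub>R x) = r *\<^sub>R (c *\<^sub>C x)" for r and x :: 'a
    by (metis mult.commute scaleC_of_real scaleC_scaleC)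
qed (simp_all add: scaleC_add_right norm_scaleC)

lemma orthogonal_cinner: "cinner x y = 0 \<Longrightarrow> orthogonal x y" for x :: "'a::complex_inner"
  by (metis Re_cinner orthogonal_def zero_complex.simps(1))

lemma cinner_eq_0_commute: "cinner x y = 0 \<longleftrightarrow> cinner y x = 0" for x :: "'a::complex_inner"
  by (metis cinner_commute complex_cnj_zero)

lemma norm_cinner_commute: "cmod (cinner x y) = cmod (cinner y x)" for x :: "'a::complex_inner"
  by (metis cinner_commute complex_mod_cnj)

lemma cinner_left_ext: "(\<And>x. cinner x y = cinner x z) \<Longrightarrow> y = z" for y :: "'a::complex_inner"
proof -
  assume "\<And>x. cinner x y = cinner x z"
  then have "cinner (y - z) (y - z) = 0" by (simp add: cinner_diff_right)
  then show "y = z" by (simp add: cinner_self)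
qed

lemma bounded_clinearD:
  assumes "bounded_clinear A"
  shows "bounded_linear A" "A (c *\<^sub>C x) = c *\<^sub>C A x"
  using assms by (simp_all add: bounded_clinear_def)

lemma bounded_clinear_sum_scaleC:
  assumes "bounded_clinear A"
  shows "A (\<Sum>j\<in>J. c j *\<^sub>C e j) = (\<Sum>j\<in>J. c j *\<^sub>C A (e j))"
  using assms
  by (simp add: bounded_clinear_def linear_sum[OF bounded_linear.linear])

section \<open>Orthonormal systems padded with zeros\<close>

text \<open>
  Zero vectors are admitted because the space may have finite dimension whereas all sequences here
  are infinite.
\<close>

definition orthonormal_or_zero :: "('i \<Rightarrow> 'a::complex_inner) \<Rightarrow> bool" where
  "orthonormal_or_zero e \<longleftrightarrow>
     (\<forall>i j. i \<noteq> j \<longrightarrow> cinner (e i) (e j) = 0) \<and> (\<forall>i. e i = 0 \<or> norm (e i) = 1)"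

lemma orthonormal_or_zeroD:
  assumes "orthonormal_or_zero e"
  shows "i \<noteq> j \<Longrightarrow> cinner (e i) (e j) = 0" and "e i = 0 \<or> norm (e i) = 1" and "norm (e i) \<le> 1"
  using assms by (auto simp: orthonormal_or_zero_def) (metis norm_zero zero_le_one order_refl)

lemma cinner_remainder:
  assumes e: "orthonormal_or_zero e" and "finite J" "i \<in> J"
  shows "cinner (x - (\<Sum>j\<in>J. cinner x (e j) *\<^sub>C e j)) (e i) = 0"
proof -
  have "(\<Sum>j\<in>J. cinner x (e j) * cinner (e j) (e i)) = (\<Sum>j\<in>J. if j = i then cinner x (e i) else 0)"
  proof (rule sum.cong[OF refl])
    fix j
    \<comment> \<open>If \<open>e i\<close> is a padding zero, both sides vanish because
      \<open>cinner x 0 = 0\<close>.\<close>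
    show "cinner x (e j) * cinner (e j) (e i) = (if j = i then cinner x (e i) else 0)"
      using orthonormal_or_zeroD(1)[OF e, of j i] orthonormal_or_zeroD(2)[OF e, of i]
      by (auto simp: cinner_self)
  qed
  then show ?thesis
    using assms(2,3) by (simp add: cinner_diff_left cinner_sum_left cinner_scaleC_left)
qed

lemma norm_sum_scaleC_orthonormal:
  assumes e: "orthonormal_or_zero e" and "finite J"
  shows "(norm (\<Sum>j\<in>J. c j *\<^sub>C e j))\<^sup>2 = (\<Sum>j\<in>J. (cmod (c j) * norm (e j))\<^sup>2)"
proof -
  have "(norm (\<Sum>j\<in>J. c j *\<^sub>C e j))\<^sup>2 = (\<Sum>j\<in>J. (norm (c j *\<^sub>C e j))\<^sup>2)"
    using assms orthonormal_or_zeroD(1)[OF e]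
    by (intro norm_sum_Pythagorean)
      (auto simp: pairwise_def cinner_scaleC_left cinner_scaleC_right intro!: orthogonal_cinner)
  then show ?thesis by (simp add: norm_scaleC)
qed

lemma
  assumes e: "orthonormal_or_zero e" and J: "finite J"
  shows bessel_inequality: "(\<Sum>j\<in>J. (cmod (cinner x (e j)))\<^sup>2) \<le> (norm x)\<^sup>2"
    and norm_remainder_le: "norm (x - (\<Sum>j\<in>J. cinner x (e j) *\<^sub>C e j)) \<le> norm x"
proof -
  let ?p = "\<Sum>j\<in>J. cinner x (e j) *\<^sub>C e j"
  have "cinner (x - ?p) ?p = 0"
    using cinner_remainder[OF e J] by (simp add: cinner_sum_right cinner_scaleC_right)
  then have "(norm (x - ?p + ?p))\<^sup>2 = (norm (x - ?p))\<^sup>2 + (norm ?p)\<^sup>2"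
    by (intro norm_add_Pythagorean orthogonal_cinner)
  then have *: "(norm x)\<^sup>2 = (norm (x - ?p))\<^sup>2 + (norm ?p)\<^sup>2" by simp
  have "(cmod (cinner x (e j)) * norm (e j))\<^sup>2 = (cmod (cinner x (e j)))\<^sup>2" for j
    using orthonormal_or_zeroD(2)[OF e, of j] by auto
  then have "(norm ?p)\<^sup>2 = (\<Sum>j\<in>J. (cmod (cinner x (e j)))\<^sup>2)"
    unfolding norm_sum_scaleC_orthonormal[OF e J] by (intro sum.cong refl)
  with * show "(\<Sum>j\<in>J. (cmod (cinner x (e j)))\<^sup>2) \<le> (norm x)\<^sup>2" by simp
  have "(norm (x - ?p))\<^sup>2 \<le> (norm x)\<^sup>2" using * by simp
  then show "norm (x - ?p) \<le> norm x" by (rule power2_le_imp_le) simp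
qed

section \<open>The Schmidt decomposition of a compact operator\<close>

text \<open>First-order optimality. If \<open>A x\<close> had a component along \<open>A r\<close>,
  a small step from \<open>r\<close> in the direction of \<open>x\<close> would increase the squared
  norm of the image to first order, whereas orthogonality of \<open>x\<close> and \<open>r\<close>
  lets the squared norm of the argument grow only to second order. This makes the images of
  successive maximizers orthogonal without an adjoint.\<close>

lemma cinner_image_norm_maximizer:
  assumes A: "bounded_clinear A"
    and V: "\<And>x y. x \<in> V \<Longrightarrow> y \<in> V \<Longrightarrow> x + y \<in> V" "\<And>c x. x \<in> V \<Longrightarrow> c *\<^sub>C x \<in> V"
    and r: "r \<in> V" "r = 0 \<or> norm r = 1"
    and max: "\<And>x. x \<in> V \<Longrightarrow> norm (A x) \<le> norm (A r) * norm x"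
    and x: "x \<in> V" "cinner x r = 0"
  shows "cinner (A x) (A r) = 0"
proof (rule ccontr)
  define c where "c = cinner (A x) (A r)"
  interpret A: bounded_linear A using A by (rule bounded_clinearD)
  assume "cinner (A x) (A r) \<noteq> 0"
  then have c: "c \<noteq> 0" by (simp add: c_def)
  then have "r \<noteq> 0" by (auto simp: c_def A.zero)
  then have r1: "norm r = 1" using r by simp
  define K where "K = (norm (A r) * norm x)\<^sup>2"
  have *: "2 * t \<le> t\<^sup>2 * K" if "t > 0" for t
  proof -
    \<comment> \<open>The factor \<open>cnj c\<close> rotates \<open>x\<close> so that the cross
      term becomes the nonnegative real \<open>t * (cmod c)\<^sup>2\<close>.\<close>
    define y where "y = complex_of_real t *\<^sub>C cnj c *\<^sub>C x"
    have "cinner r y = 0" using x cinner_eq_0_commute[of x r]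
      by (simp add: y_def cinner_scaleC_right)
    then have "(norm (r + y))\<^sup>2 = (norm r)\<^sup>2 + (norm y)\<^sup>2"
      by (intro norm_add_Pythagorean orthogonal_cinner)
    then have ny: "(norm (r + y))\<^sup>2 = 1 + t\<^sup>2 * (cmod c)\<^sup>2 * (norm x)\<^sup>2"
      by (simp add: r1 y_def norm_scaleC norm_mult power_mult_distrib)
    have "norm (A (r + y)) \<le> norm (A r) * norm (r + y)"
      using V r(1) x(1) by (intro max) (simp add: y_def)
    then have "(norm (A (r + y)))\<^sup>2 \<le> (norm (A r))\<^sup>2 * (norm (r + y))\<^sup>2"
      by (simp flip: power_mult_distrib)
    moreover have "(norm (A (r + y)))\<^sup>2 = (norm (A r))\<^sup>2 + 2 * inner (A y) (A r) + (norm (A y))\<^sup>2"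
      by (simp add: A.add power2_norm_eq_inner algebra_simps inner_commute)
    moreover have "inner (A y) (A r) = t * (cmod c)\<^sup>2"
    proof -
      have "cinner (A y) (A r) = complex_of_real t * (c * cnj c)"
        by (simp add: y_def bounded_clinearD(2)[OF A] cinner_scaleC_left flip: c_def)
      also have "\<dots> = complex_of_real (t * (cmod c)\<^sup>2)"
        by (simp flip: complex_norm_square)
      finally show ?thesis by (metis Re_cinner Re_complex_of_real)
    qed
    ultimately have "(norm (A y))\<^sup>2 + (2 * t) * (cmod c)\<^sup>2 \<le> (t\<^sup>2 * K) * (cmod c)\<^sup>2"
      unfolding ny K_def by (simp add: algebra_simps power_mult_distrib)
    then have "(2 * t) * (cmod c)\<^sup>2 \<le> (t\<^sup>2 * K) * (cmod c)\<^sup>2"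
      using zero_le_power2[of "norm (A y)"] by linarith
    then show ?thesis using c by simp
  qed
  have K: "0 \<le> K" by (simp add: K_def)
  \<comment> \<open>The inequality \<open>*\<close> fails once \<open>t * K < 2\<close>; the choice
    \<open>t = 1 / (K + 1)\<close> also covers \<open>K = 0\<close>.\<close>
  have "2 * (1 / (K + 1)) \<le> (1 / (K + 1))\<^sup>2 * K" using K by (intro *) simp
  then have "2 * (K + 1) \<le> K" using K by (simp add: divide_simps power2_eq_square split: if_splits)
  then show False using K by simp
qed

lemma compact_operatorD:
  assumes "compact_operator A"
  shows "bounded_clinear A" "bounded_linear A" "compact (closure (A ` cball 0 1))"
  using assms by (auto simp: compact_operator_def bounded_clinear_def)

text \<open>Only the right singular vectors are recorded: the norm of \<open>A (e j)\<close> is the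
  singular value and its direction the left singular vector. The last clause is the quantitative
  form of the Schmidt expansion, from which both its convergence and the uniqueness of the positive
  root are derived.\<close>

definition schmidt_system :: "('a::complex_inner \<Rightarrow> 'a) \<Rightarrow> (nat \<Rightarrow> 'a) \<Rightarrow> bool" where
  "schmidt_system A e \<longleftrightarrow> orthonormal_or_zero e \<and>
     (\<forall>i j. i \<noteq> j \<longrightarrow> cinner (A (e i)) (A (e j)) = 0) \<and>
     (\<lambda>j. norm (A (e j))) \<in> c0_star \<and>
     (\<forall>J x. norm (A x - (\<Sum>j<J. cinner x (e j) *\<^sub>C A (e j))) \<le> norm (A (e J)) * norm x)"

lemma exists_schmidt_system:
  fixes A :: "'a::chilbert_space \<Rightarrow> 'a"
  assumes "compact_operator A"
  shows "\<exists>e. schmidt_system A e"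
proof -
  interpret A: bounded_linear A using assms by (rule compact_operatorD)
  define V where "V e j = {x. \<forall>i<j. cinner x (e i) = 0}" for e :: "nat \<Rightarrow> 'a" and j :: nat
  have V_add: "x + y \<in> V e j" if "x \<in> V e j" "y \<in> V e j" for x y e j
    using that by (simp add: V_def cinner_add_left)
  have V_scale: "c *\<^sub>C x \<in> V e j" if "x \<in> V e j" for c x e j
    using that by (simp add: V_def cinner_scaleC_left)
  have V_sub: "subspace (V e j)" for e j
    by (rule subspaceI) (auto simp: V_def cinner_add_left cinner_scaleR_left)
  have V_closed: "closed (V e j)" for e j
  proof -
    have "V e j = (\<Inter>i\<in>{..<j}. {x. cinner x (e i) = 0})" by (auto simp: V_def)
    moreover have "closed {x. cinner x (e i) = 0}" for i
      by (intro closed_Collect_eq continuous_on_const linear_continuous_on bounded_linear_cinner_left)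
    ultimately show ?thesis by (auto intro!: closed_INT)
  qed
  let ?P = "\<lambda>e j r. r \<in> V e j \<and> (r = 0 \<or> norm r = 1) \<and>
    (\<forall>x\<in>V e j. norm (A x) \<le> norm (A r) * norm x)"
  have "\<exists>e. \<forall>j. ?P e j (e j)"
  proof (rule dependent_wellorder_choice)
    \<comment> \<open>The constraint on the \<open>j\<close>-th vector involves only the earlier
      ones, which is what licenses the recursive choice.\<close>
    fix r :: 'a and e e' :: "nat \<Rightarrow> 'a" and j :: nat assume "\<And>i. i < j \<Longrightarrow> e i = e' i"
    then have "V e j = V e' j" by (auto simp: V_def)
    then show "?P e j r = ?P e' j r" by simp
  next
    fix j :: nat and e :: "nat \<Rightarrow> 'a"
    show "\<exists>r. ?P e j r"
      using compact_linear_norm_attained[OF compact_operatorD(2,3)[OF assms] V_closed V_sub]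
      by blast
  qed
  then obtain e where eV: "\<And>j. e j \<in> V e j" and e1: "\<And>j. e j = 0 \<or> norm (e j) = 1"
    and max: "\<And>j x. x \<in> V e j \<Longrightarrow> norm (A x) \<le> norm (A (e j)) * norm x"
    by blast
  have "cinner (e i) (e j) = 0" if "i \<noteq> j" for i j
    using eV[of i] eV[of j] that cinner_eq_0_commute[of "e i" "e j"]
    by (auto simp: V_def linorder_neq_iff)
  then have on: "orthonormal_or_zero e" using e1 by (simp add: orthonormal_or_zero_def)
  have V_mono: "V e j \<subseteq> V e i" if "i \<le> j" for i j using that by (auto simp: V_def)
  have less: "cinner (A (e j)) (A (e i)) = 0" if "i < j" for i j
  proof (rule cinner_image_norm_maximizer[where A = A and x = "e j" and r = "e i" and V = "V e i"])
    show "e j \<in> V e i" using eV[of j] V_mono[of i j] that by auto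
    show "cinner (e j) (e i) = 0" using that by (intro orthonormal_or_zeroD(1)[OF on]) simp
  qed (use compact_operatorD[OF assms] V_add V_scale eV e1 max in auto)
  then have orth: "cinner (A (e i)) (A (e j)) = 0" if "i \<noteq> j" for i j
    using that less[of i j] less[of j i] cinner_eq_0_commute by (auto simp: linorder_neq_iff)
  have dec: "decseq (\<lambda>j. norm (A (e j)))"
  proof (rule decseq_SucI)
    fix j
    have "norm (A (e (Suc j))) \<le> norm (A (e j)) * norm (e (Suc j))"
      using eV[of "Suc j"] V_mono[of j "Suc j"] by (intro max) auto
    also have "\<dots> \<le> norm (A (e j)) * 1"
      by (intro mult_left_mono orthonormal_or_zeroD(3)[OF on]) simp
    finally show "norm (A (e (Suc j))) \<le> norm (A (e j))" by simp
  qed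
  \<comment> \<open>If the norms stayed above \<open>L > 0\<close>, the images
    \<open>A (e j)\<close> would be mutually orthogonal and hence at least \<open>L\<close> apart,
    so no subsequence could converge.\<close>
  have lim: "(\<lambda>j. norm (A (e j))) \<longlonglongrightarrow> 0"
  proof (rule ccontr)
    assume not0: "\<not> ?thesis"
    obtain L where L: "(\<lambda>j. norm (A (e j))) \<longlonglongrightarrow> L" "\<And>j. L \<le> norm (A (e j))"
      using decseq_convergent[OF dec, of 0] by auto
    have "0 \<le> L" using L(1) by (intro LIMSEQ_le_const[OF L(1)]) auto
    with not0 L(1) have L0: "L > 0" by (cases "L = 0") auto
    have "A (e j) \<in> closure (A ` cball 0 1)" for j
      using orthonormal_or_zeroD(3)[OF on]
      by (intro subsetD[OF closure_subset] imageI) simp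
    then obtain y \<phi> where \<phi>: "strict_mono \<phi>" and y: "(\<lambda>n. A (e (\<phi> n))) \<longlonglongrightarrow> y"
      by (rule compact_convergent_subsequence[OF compact_operatorD(3)[OF assms]])
    obtain M where M: "\<And>m n. m \<ge> M \<Longrightarrow> n \<ge> M \<Longrightarrow> norm (A (e (\<phi> m)) - A (e (\<phi> n))) < L"
      using CauchyD[OF LIMSEQ_imp_Cauchy[OF y] L0] by blast
    have "\<phi> M \<noteq> \<phi> (Suc M)" using \<phi> by (metis lessI less_irrefl strict_mono_less)
    then have "orthogonal (A (e (\<phi> M))) (- A (e (\<phi> (Suc M))))"
      using orth by (simp add: orthogonal_cinner orthogonal_clauses)
    from norm_add_Pythagorean[OF this]
    have "(norm (A (e (\<phi> M))))\<^sup>2 \<le> (norm (A (e (\<phi> M)) - A (e (\<phi> (Suc M)))))\<^sup>2" by simp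
    then have "norm (A (e (\<phi> M))) \<le> norm (A (e (\<phi> M)) - A (e (\<phi> (Suc M))))"
      by (rule power2_le_imp_le) simp
    then show False using M[of M "Suc M"] L(2)[of "\<phi> M"] by simp
  qed
  have "norm (A x - (\<Sum>j<J. cinner x (e j) *\<^sub>C A (e j))) \<le> norm (A (e J)) * norm x" for J x
  proof -
    \<comment> \<open>Removing the first \<open>J\<close> components puts \<open>?y\<close> into
      \<open>V e J\<close>, where \<open>e J\<close> is the maximizer.\<close>
    let ?y = "x - (\<Sum>j<J. cinner x (e j) *\<^sub>C e j)"
    have "A x - (\<Sum>j<J. cinner x (e j) *\<^sub>C A (e j)) = A ?y"
      by (simp add: A.diff bounded_clinear_sum_scaleC[OF compact_operatorD(1)[OF assms]])
    moreover have "norm (A ?y) \<le> norm (A (e J)) * norm ?y"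
      using cinner_remainder[OF on, of "{..<J}"] by (intro max) (simp add: V_def)
    moreover have "\<dots> \<le> norm (A (e J)) * norm x"
      by (intro mult_left_mono norm_remainder_le[OF on]) auto
    ultimately show ?thesis by simp
  qed
  then show ?thesis
    using on orth dec lim unfolding schmidt_system_def c0_star_def by auto
qed

section \<open>Diagonal operators\<close>

text \<open>One formula for three operators: \<open>A\<close> itself when \<open>g\<close> is the
  left system, its adjoint after exchanging the two systems, and its absolute value when
  \<open>g = e\<close>.\<close>

definition diag_op ::
  "(nat \<Rightarrow> real) \<Rightarrow> (nat \<Rightarrow> 'a::complex_inner) \<Rightarrow> (nat \<Rightarrow> 'a) \<Rightarrow> 'a \<Rightarrow> 'a" where
  "diag_op s e g x = (\<Sum>\<^sub>\<infinity>j. (complex_of_real (s j) * cinner x (e j)) *\<^sub>C g j)"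

locale diagonal =
  fixes s :: "nat \<Rightarrow> real" and e g :: "nat \<Rightarrow> 'a::chilbert_space"
  assumes s: "Bseq s" and e: "orthonormal_or_zero e" and g: "orthonormal_or_zero g"
begin

lemma diag_op_bounds:
  obtains B where "\<And>x. ((\<lambda>j. (complex_of_real (s j) * cinner x (e j)) *\<^sub>C g j) has_sum diag_op s e g x) UNIV"
    "\<And>x. norm (diag_op s e g x) \<le> norm x * B"
proof -
  obtain B where B: "B > 0" "\<And>j. norm (s j) \<le> B" using s by (auto elim: BseqE)
  let ?t = "\<lambda>x j. (complex_of_real (s j) * cinner x (e j)) *\<^sub>C g j"
  have orth: "pairwise (\<lambda>i j. orthogonal (?t x i) (?t x j)) UNIV" for x
    using orthonormal_or_zeroD(1)[OF g]
    by (auto simp: pairwise_def cinner_scaleC_left cinner_scaleC_right intro!: orthogonal_cinner)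
  have le: "(\<Sum>j\<in>F. (norm (?t x j))\<^sup>2) \<le> (norm x * B)\<^sup>2" if "finite F" for F x
  proof -
    have "norm (?t x j) \<le> B * cmod (cinner x (e j)) * 1" for j
      unfolding norm_scaleC norm_mult using B(2)[of j] orthonormal_or_zeroD(3)[OF g, of j]
      by (intro mult_mono) (auto intro: order_trans)
    then have "(\<Sum>j\<in>F. (norm (?t x j))\<^sup>2) \<le> (\<Sum>j\<in>F. (B * cmod (cinner x (e j)))\<^sup>2)"
      by (intro sum_mono power_mono) auto
    also have "\<dots> = B\<^sup>2 * (\<Sum>j\<in>F. (cmod (cinner x (e j)))\<^sup>2)"
      by (simp add: sum_distrib_left power_mult_distrib)
    also have "\<dots> \<le> B\<^sup>2 * (norm x)\<^sup>2"
      by (intro mult_left_mono bessel_inequality[OF e that]) auto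
    finally show ?thesis by (simp add: power_mult_distrib mult.commute)
  qed
  show thesis
  proof (rule that)
    fix x
    show "(?t x has_sum diag_op s e g x) UNIV" unfolding diag_op_def
      by (intro has_sum_infsum summable_on_orthogonal_bounded[OF orth le]) (use B(1) in auto)
    show "norm (diag_op s e g x) \<le> norm x * B" unfolding diag_op_def
      by (intro norm_infsum_orthogonal_le[OF orth le]) (use B(1) in auto)
  qed
qed

lemma has_sum_diag_op:
  "((\<lambda>j. (complex_of_real (s j) * cinner x (e j)) *\<^sub>C g j) has_sum diag_op s e g x) UNIV"
  by (rule diag_op_bounds) blast

lemma diag_op_eqI:
  "((\<lambda>j. (complex_of_real (s j) * cinner x (e j)) *\<^sub>C g j) has_sum y) UNIV \<Longrightarrow> diag_op s e g x = y"
  using has_sum_diag_op by (rule has_sum_unique)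

lemma bounded_clinear_diag_op: "bounded_clinear (diag_op s e g)"
proof -
  have add: "diag_op s e g (x + y) = diag_op s e g x + diag_op s e g y" for x y
    using has_sum_add[OF has_sum_diag_op[of x] has_sum_diag_op[of y]]
    by (intro diag_op_eqI) (simp add: cinner_add_left distrib_left scaleC_add_left)
  have scale: "diag_op s e g (c *\<^sub>C x) = c *\<^sub>C diag_op s e g x" for c x
    using has_sum_bounded_linear[OF bounded_linear_scaleC_right has_sum_diag_op[of x], of c]
    by (intro diag_op_eqI) (simp add: cinner_scaleC_left scaleC_scaleC mult_ac)
  obtain B where "\<And>x. norm (diag_op s e g x) \<le> norm x * B" using diag_op_bounds by metis
  then have "bounded_linear (diag_op s e g)"
    using add scale[of "complex_of_real _"] by (intro bounded_linear_intro) (simp_all add: scaleC_of_real)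
  then show ?thesis using scale by (simp add: bounded_clinear_def)
qed

lemma diag_op_basis: "diag_op s e g (e j) = complex_of_real (s j * (norm (e j))\<^sup>2) *\<^sub>C g j"
proof -
  have "diag_op s e g (e j) = (\<Sum>\<^sub>\<infinity>i\<in>{j}. (complex_of_real (s i) * cinner (e j) (e i)) *\<^sub>C g i)"
    unfolding diag_op_def using orthonormal_or_zeroD(1)[OF e, of j]
    by (intro infsum_cong_neutral) auto
  then show ?thesis by (simp add: cinner_self)
qed

end

text \<open>The weights are real, so exchanging the two systems yields the adjoint explicitly, with
  no appeal to Riesz representation.\<close>

lemma cinner_diag_op_left:
  fixes e g :: "nat \<Rightarrow> 'a::chilbert_space"
  assumes "diagonal s e g"
  shows "cinner (diag_op s e g x) y = cinner x (diag_op s g e y)"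
proof -
  interpret eg: diagonal s e g by fact
  interpret ge: diagonal s g e using assms by (simp add: diagonal_def)
  have "cinner ((complex_of_real (s j) * cinner x (e j)) *\<^sub>C g j) y =
      cinner x ((complex_of_real (s j) * cinner y (g j)) *\<^sub>C e j)" for j
    by (simp add: cinner_scaleC_left cinner_scaleC_right mult_ac cinner_commute[of y "g j"])
  then show ?thesis
    using has_sum_bounded_linear[OF bounded_linear_cinner_left eg.has_sum_diag_op[of x], of y]
      has_sum_bounded_linear[OF bounded_linear_cinner_right ge.has_sum_diag_op[of y], of x]
    by (simp add: has_sum_unique)
qed

lemma positive_operator_diag_op:
  assumes "diagonal s e e" and nonneg: "\<And>j. 0 \<le> s j"
  shows "positive_operator (diag_op s e e)"
proof -
  interpret diagonal s e e by fact
  have "cinner (diag_op s e e x) x \<in> \<real> \<and> 0 \<le> Re (cinner (diag_op s e e x) x)" for x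
  proof -
    have eq: "cinner ((complex_of_real (s j) * cinner x (e j)) *\<^sub>C e j) x
        = complex_of_real (s j * (cmod (cinner x (e j)))\<^sup>2)" for j
      by (simp add: cinner_scaleC_left complex_norm_square cinner_commute[of "e j" x] mult_ac
          del: of_real_power)
    have *: "((\<lambda>j. complex_of_real (s j * (cmod (cinner x (e j)))\<^sup>2)) has_sum cinner (diag_op s e e x) x) UNIV"
      using has_sum_bounded_linear[OF bounded_linear_cinner_left has_sum_diag_op[of x], of x]
      unfolding eq .
    have "Im (cinner (diag_op s e e x) x) = 0"
      using has_sum_unique[OF has_sum_Im[OF *]] by simp
    moreover have "0 \<le> Re (cinner (diag_op s e e x) x)"
      by (rule has_sum_nonneg[OF has_sum_Re[OF *]]) (simp add: nonneg)
    ultimately show ?thesis by (simp add: complex_is_Real_iff)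
  qed
  then show ?thesis using bounded_clinear_diag_op by (simp add: positive_operator_def)
qed

text \<open>Self-adjointness makes an eigenvector for \<open>r\<close> orthogonal to every
  \<open>e j\<close> with \<open>s j \<noteq> r\<close>, so its series collapses to a finite sum,
  and dividing by \<open>r\<close> puts it into the span. For \<open>r = 0\<close> the kernel could
  be larger, as \<open>e\<close> need not be complete.\<close>

lemma eigenspace_diag_op:
  assumes "diagonal s e e" and r: "r \<noteq> 0" and fin: "finite {j. s j = r}"
    and nz: "\<And>j. s j = r \<Longrightarrow> e j \<noteq> 0"
  shows "eigenspace (diag_op s e e) (complex_of_real r) = complex_vector.span (e ` {j. s j = r})"
proof -
  interpret diagonal s e e by fact
  note R = bounded_clinear_diag_op
  show ?thesis
  proof (intro equalityI subsetI)
    fix x assume "x \<in> eigenspace (diag_op s e e) (complex_of_real r)"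
    then have x: "diag_op s e e x = complex_of_real r *\<^sub>C x" by (simp add: eigenspace_def)
    have zero: "cinner x (e j) = 0" if "s j \<noteq> r" for j
    proof (cases "e j = 0")
      case False
      then have "norm (e j) = 1" using orthonormal_or_zeroD(2)[OF e] by blast
      then have "complex_of_real r * cinner x (e j) = complex_of_real (s j) * cinner x (e j)"
        using cinner_diag_op_left[OF assms(1), of x "e j"]
        by (simp add: x diag_op_basis cinner_scaleC_left cinner_scaleC_right)
      then show ?thesis using that by simp
    qed simp
    have "complex_of_real r *\<^sub>C x = (\<Sum>j | s j = r. (complex_of_real (s j) * cinner x (e j)) *\<^sub>C e j)"
      unfolding x[symmetric] diag_op_def infsum_finite[OF fin, symmetric]
      using zero by (intro infsum_cong_neutral) auto
    also have "\<dots> = complex_of_real r *\<^sub>C (\<Sum>j | s j = r. cinner x (e j) *\<^sub>C e j)"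
      by (simp add: complex_vector.scale_sum_right)
    finally have "x = (\<Sum>j | s j = r. cinner x (e j) *\<^sub>C e j)" using r by simp
    moreover have "(\<Sum>j | s j = r. cinner x (e j) *\<^sub>C e j) \<in> complex_vector.span (e ` {j. s j = r})"
      by (intro complex_vector.span_sum complex_vector.span_scale complex_vector.span_base imageI)
    ultimately show "x \<in> complex_vector.span (e ` {j. s j = r})" by simp
  next
    fix x assume "x \<in> complex_vector.span (e ` {j. s j = r})"
    then show "x \<in> eigenspace (diag_op s e e) (complex_of_real r)"
    proof (rule subsetD[OF complex_vector.span_minimal, rotated 2])
      show "complex_vector.subspace (eigenspace (diag_op s e e) (complex_of_real r))"
        using R bounded_linear.linear[OF bounded_clinearD(1)[OF R]]
        by (auto simp: complex_vector.subspace_def eigenspace_def bounded_clinear_def linear_0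
            linear_add scaleC_add_right mult.commute)
      show "e ` {j. s j = r} \<subseteq> eigenspace (diag_op s e e) (complex_of_real r)"
      proof (intro image_subsetI, unfold mem_Collect_eq)
        fix j assume j: "s j = r"
        then have "norm (e j) = 1" using orthonormal_or_zeroD(2)[OF e, of j] nz by blast
        then show "e j \<in> eigenspace (diag_op s e e) (complex_of_real r)"
          by (simp add: eigenspace_def diag_op_basis j)
      qed
    qed
  qed
qed

lemma dim_span_orthonormal:
  assumes e: "orthonormal_or_zero e" and nz: "\<And>j. j \<in> J \<Longrightarrow> e j \<noteq> 0"
  shows "complex_vector.dim (complex_vector.span (e ` J)) = card J"
proof -
  have inj: "inj_on e J"
  proof (rule inj_onI)
    fix i j assume ij: "i \<in> J" "j \<in> J" "e i = e j"
    then have "cinner (e i) (e j) \<noteq> 0" using nz by (simp add: cinner_self)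
    then show "i = j" using orthonormal_or_zeroD(1)[OF e] by blast
  qed
  have "complex_vector.independent (e ` J)"
    unfolding complex_vector.independent_explicit_finite_subsets
  proof (intro allI impI ballI)
    fix S u w assume S: "S \<subseteq> e ` J" "finite S" "(\<Sum>v\<in>S. u v *\<^sub>C v) = 0" and w: "w \<in> S"
    have "(\<Sum>v\<in>S. u v * cinner v w) = cinner (\<Sum>v\<in>S. u v *\<^sub>C v) w"
      by (simp add: cinner_sum_left cinner_scaleC_left)
    also have "\<dots> = 0" using S(3) by simp
    also have "(\<Sum>v\<in>S. u v * cinner v w) = (\<Sum>v\<in>S. if v = w then u w * cinner w w else 0)"
    proof (rule sum.cong[OF refl])
      fix v assume "v \<in> S"
      with S w obtain i j where "v = e i" "w = e j" by blast
      then show "u v * cinner v w = (if v = w then u w * cinner w w else 0)"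
        using orthonormal_or_zeroD(1)[OF e, of i j] by auto
    qed
    finally have "u w * cinner w w = 0" using S(2) w by simp
    moreover have "w \<noteq> 0" using S w nz by auto
    ultimately show "u w = 0" by (simp add: cinner_self)
  qed
  then show ?thesis
    using complex_vector.dim_span_eq_card_independent card_image[OF inj] by metis
qed

section \<open>The absolute value and the singular values\<close>

lemma cadjointI:
  assumes "\<And>x y. cinner (A x) y = cinner x (B y)"
  shows "cadjoint A = B"
  unfolding cadjoint_def
proof (rule the_equality)
  fix C assume C: "\<forall>x y. cinner (A x) y = cinner x (C y)"
  have "cinner x (C y) = cinner x (B y)" for x y
    by (rule trans[OF C[rule_format, symmetric] assms])
  then show "C = B" by (rule ext[OF cinner_left_ext])
qed (use assms in simp)

text \<open>Polarization: real values at \<open>x + y\<close> make the imaginary parts of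
  \<open>cinner (R x) y\<close> and \<open>cinner (R y) x\<close> opposite, and real values at
  \<open>x + \<i> *\<^sub>C y\<close> make their real parts equal.\<close>

lemma positive_operator_selfadjoint:
  assumes "positive_operator R"
  shows "cinner (R x) y = cinner x (R y)"
proof -
  have R: "bounded_clinear R" and real: "\<And>x. Im (cinner (R x) x) = 0"
    using assms by (auto simp: positive_operator_def complex_is_Real_iff)
  interpret bounded_linear R using R by (rule bounded_clinearD)
  have "Im (cinner (R x) y + cinner (R y) x) = 0"
    using real[of "x + y"] real[of x] real[of y] by (simp add: add cinner_add_left cinner_add_right)
  moreover have "Re (cinner (R y) x - cinner (R x) y) = 0"
    using real[of "x + \<i> *\<^sub>C y"] real[of x] real[of y]
    by (simp add: add cinner_add_left cinner_add_right bounded_clinearD(2)[OF R]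
        cinner_scaleC_left cinner_scaleC_right)
  ultimately have "cinner (R x) y = cnj (cinner (R y) x)" by (simp add: complex_eq_iff)
  then show ?thesis using cinner_commute by metis
qed

text \<open>Factor \<open>R\<^sup>2 - s\<^sup>2\<close> as \<open>(R + s) (R - s)\<close>: the
  vector \<open>y = (R - s) x\<close> satisfies \<open>R y = - s y\<close>, which for
  \<open>s > 0\<close> contradicts positivity unless \<open>y = 0\<close>.\<close>

lemma positive_operator_root_eigenvector:
  assumes R: "positive_operator R" and s: "0 \<le> s"
    and x: "R (R x) = complex_of_real (s\<^sup>2) *\<^sub>C x"
  shows "R x = complex_of_real s *\<^sub>C x"
proof (cases "s = 0")
  case True
  then have "cinner (R x) (R x) = 0"
    using x by (simp flip: positive_operator_selfadjoint[OF R])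
  then show ?thesis using True by (simp add: cinner_self)
next
  case False
  with s have s0: "s > 0" by simp
  have Rl: "bounded_clinear R" using R by (simp add: positive_operator_def)
  interpret bounded_linear R using Rl by (rule bounded_clinearD)
  define y where "y = R x - complex_of_real s *\<^sub>C x"
  have "R y = - (complex_of_real s *\<^sub>C y)"
    by (simp add: y_def diff x bounded_clinearD(2)[OF Rl] power2_eq_square
        complex_vector.scale_right_diff_distrib)
  then have "cinner (R y) y = - complex_of_real (s * (norm y)\<^sup>2)"
    by (metis (no_types) cinner_scaleC_left cinner_self complex_vector.scale_minus_left
        mult_minus_left of_real_mult)
  moreover have "0 \<le> Re (cinner (R y) y)" using R by (simp add: positive_operator_def)
  ultimately have "s * (norm y)\<^sup>2 \<le> 0" by simp
  then have "y = 0" using s0 by (simp add: mult_le_0_iff)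
  then show ?thesis by (simp add: y_def)
qed

section \<open>Adjoint and absolute value from a Schmidt system\<close>

locale schmidt =
  fixes A :: "'a::chilbert_space \<Rightarrow> 'a" and e :: "nat \<Rightarrow> 'a"
  assumes A: "bounded_clinear A" and sch: "schmidt_system A e"
begin

definition sv :: "nat \<Rightarrow> real" where "sv j = norm (A (e j))"
text \<open>Since \<open>sgn 0 = 0\<close>, indices with \<open>A (e j) = 0\<close> receive a
  padding zero and the left system is again \<open>orthonormal_or_zero\<close>.\<close>

definition left :: "nat \<Rightarrow> 'a" where "left j = sgn (A (e j))"

lemma orthonormal_right: "orthonormal_or_zero e"
  using sch by (simp add: schmidt_system_def)

lemma orthonormal_left: "orthonormal_or_zero left"
proof -
  have "cinner (left i) (left j) = 0" if "i \<noteq> j" for i j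
    using sch that
    by (simp add: schmidt_system_def left_def sgn_div_norm cinner_scaleR_left cinner_scaleR_right)
  then show ?thesis by (simp add: orthonormal_or_zero_def left_def norm_sgn)
qed

lemma sv_c0_star: "sv \<in> c0_star"
  using sch by (simp add: schmidt_system_def sv_def[abs_def])

lemma sv_nonneg: "0 \<le> sv j" by (simp add: sv_def)

lemma sv_tendsto: "sv \<longlonglongrightarrow> 0" using sv_c0_star by (simp add: c0_star_def)

lemma sv_left: "A (e j) = complex_of_real (sv j) *\<^sub>C left j"
  by (cases "A (e j) = 0") (simp_all add: sv_def left_def sgn_div_norm scaleC_of_real)

lemma remainder_le:
  "norm (A x - (\<Sum>j<J. cinner x (e j) *\<^sub>C A (e j))) \<le> sv J * norm x"
  using sch by (simp add: schmidt_system_def sv_def)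

lemma right_nonzero: "sv j \<noteq> 0 \<Longrightarrow> e j \<noteq> 0"
  using linear_0[OF bounded_linear.linear[OF bounded_clinearD(1)[OF A]]] by (auto simp: sv_def)

lemma diagonal_sv: "orthonormal_or_zero u \<Longrightarrow> orthonormal_or_zero v \<Longrightarrow> diagonal sv u v"
  using sv_tendsto by (simp add: diagonal_def convergent_imp_Bseq convergentI)

lemma eq_diag_op: "A = diag_op sv e left"
proof
  fix x
  interpret diagonal sv e left by (intro diagonal_sv orthonormal_left orthonormal_right)
  have "(\<lambda>J. A x - (\<Sum>j<J. cinner x (e j) *\<^sub>C A (e j))) \<longlonglongrightarrow> 0"
  proof (rule Lim_null_comparison)
    show "(\<lambda>J. sv J * norm x) \<longlonglongrightarrow> 0" using sv_tendsto by (rule tendsto_mult_left_zero)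
  qed (simp add: remainder_le)
  then have "(\<lambda>J. A x - (A x - (\<Sum>j<J. cinner x (e j) *\<^sub>C A (e j)))) \<longlonglongrightarrow> A x - 0"
    by (intro tendsto_diff tendsto_const)
  then have "(\<lambda>J. \<Sum>j<J. cinner x (e j) *\<^sub>C A (e j)) \<longlonglongrightarrow> A x" by simp
  moreover have "(\<lambda>J. \<Sum>j<J. cinner x (e j) *\<^sub>C A (e j)) \<longlonglongrightarrow> diag_op sv e left x"
    using has_sum_imp_sums[OF has_sum_diag_op[of x]]
    by (simp add: sums_def sv_left scaleC_scaleC mult.commute)
  ultimately show "A x = diag_op sv e left x" by (rule LIMSEQ_unique)
qed

lemma cadjoint_eq: "cadjoint A = diag_op sv left e"
  by (subst eq_diag_op, intro cadjointI cinner_diag_op_left diagonal_sv orthonormal_left orthonormal_right)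

lemma cinner_cadjoint: "cinner (A x) y = cinner x (cadjoint A y)"
  unfolding cadjoint_eq
  by (subst (1) eq_diag_op, intro cinner_diag_op_left diagonal_sv orthonormal_left orthonormal_right)

lemma cadjoint_left: "cadjoint A (left j) = complex_of_real (sv j) *\<^sub>C e j"
proof -
  interpret diagonal sv left e by (intro diagonal_sv orthonormal_left orthonormal_right)
  \<comment> \<open>Where \<open>left j\<close> is a padding zero, \<open>sv j\<close> is zero
    too.\<close>
  have "sv j * (norm (left j))\<^sup>2 = sv j" by (simp add: left_def sv_def norm_sgn)
  then show ?thesis by (simp only: cadjoint_eq diag_op_basis)
qed

lemma diag_op_sv_right: "diag_op sv e e (e j) = complex_of_real (sv j) *\<^sub>C e j"
proof -
  interpret diagonal sv e e by (intro diagonal_sv orthonormal_right)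
  show ?thesis using orthonormal_or_zeroD(2)[OF orthonormal_right, of j] by (auto simp: diag_op_basis)
qed

lemma abs_root: "diag_op sv e e \<circ> diag_op sv e e = cadjoint A \<circ> A"
proof
  fix x
  interpret R: diagonal sv e e by (intro diagonal_sv orthonormal_right)
  interpret L: diagonal sv e left by (intro diagonal_sv orthonormal_right orthonormal_left)
  interpret M: diagonal sv left e by (intro diagonal_sv orthonormal_right orthonormal_left)
  have "bounded_clinear (cadjoint A)"
    unfolding cadjoint_eq by (rule M.bounded_clinear_diag_op)
  note C = bounded_clinearD[OF this] bounded_clinearD[OF R.bounded_clinear_diag_op]
  let ?t = "\<lambda>j. (complex_of_real (sv j) * cinner x (e j)) *\<^sub>C (complex_of_real (sv j) *\<^sub>C e j)"
  have "(?t has_sum diag_op sv e e (diag_op sv e e x)) UNIV"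
    using has_sum_bounded_linear[OF C(3) R.has_sum_diag_op[of x]]
    unfolding C(4) diag_op_sv_right .
  moreover have "(?t has_sum cadjoint A (diag_op sv e left x)) UNIV"
    using has_sum_bounded_linear[OF C(1) L.has_sum_diag_op[of x]]
    unfolding C(2) cadjoint_left .
  ultimately show "(diag_op sv e e \<circ> diag_op sv e e) x = (cadjoint A \<circ> A) x"
    unfolding o_def by (subst (3) eq_diag_op) (rule has_sum_unique)
qed

text \<open>Uniqueness of the positive root: the limit is taken along a sequence that does not
  mention \<open>R\<close>. The root acts on each \<open>e j\<close> as multiplication by
  \<open>sv j\<close>, and \<open>norm (R y) = norm (A y)\<close>, so the remainder estimate for
  \<open>A\<close> carries over to \<open>R\<close>.\<close>

lemma positive_root_tendsto:
  assumes R: "positive_operator R" and root: "R \<circ> R = cadjoint A \<circ> A"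
  shows "(\<lambda>J. \<Sum>j<J. cinner x (e j) *\<^sub>C complex_of_real (sv j) *\<^sub>C e j) \<longlonglongrightarrow> R x"
proof -
  have Rl: "bounded_clinear R" using R by (simp add: positive_operator_def)
  interpret R: bounded_linear R using Rl by (rule bounded_clinearD)
  interpret Al: bounded_linear A using A by (rule bounded_clinearD)
  have RR: "R (R y) = cadjoint A (A y)" for y using root by (metis comp_apply)
  have M: "cadjoint A (c *\<^sub>C y) = c *\<^sub>C cadjoint A y" for c y
    unfolding cadjoint_eq
    by (intro bounded_clinearD diagonal.bounded_clinear_diag_op diagonal_sv orthonormal_left orthonormal_right)
  have Re: "R (e j) = complex_of_real (sv j) *\<^sub>C e j" for j
    by (intro positive_operator_root_eigenvector[OF R sv_nonneg])
      (simp add: RR sv_left M cadjoint_left power2_eq_square)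
  have Rn: "norm (R y) = norm (A y)" for y
  proof -
    have "cinner (R y) (R y) = cinner y (R (R y))" by (rule positive_operator_selfadjoint[OF R])
    also have "\<dots> = cinner (A y) (A y)" by (simp add: RR cinner_cadjoint)
    finally have "(norm (R y))\<^sup>2 = (norm (A y))\<^sup>2" by (simp only: cinner_self of_real_eq_iff)
    then show ?thesis by simp
  qed
  have "norm (R x - (\<Sum>j<J. cinner x (e j) *\<^sub>C complex_of_real (sv j) *\<^sub>C e j)) \<le> sv J * norm x" for J
  proof -
    let ?y = "x - (\<Sum>j<J. cinner x (e j) *\<^sub>C e j)"
    have "R x - (\<Sum>j<J. cinner x (e j) *\<^sub>C complex_of_real (sv j) *\<^sub>C e j) = R ?y"
      by (simp only: R.diff bounded_clinear_sum_scaleC[OF Rl] Re)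
    moreover have "A ?y = A x - (\<Sum>j<J. cinner x (e j) *\<^sub>C A (e j))"
      by (simp only: Al.diff bounded_clinear_sum_scaleC[OF A])
    ultimately show ?thesis using remainder_le[of x J] by (simp add: Rn)
  qed
  then have "(\<lambda>J. R x - (\<Sum>j<J. cinner x (e j) *\<^sub>C complex_of_real (sv j) *\<^sub>C e j)) \<longlonglongrightarrow> 0"
    by (intro Lim_null_comparison[OF _ tendsto_mult_left_zero[OF sv_tendsto]] always_eventually allI)
  then have "(\<lambda>J. R x - (R x - (\<Sum>j<J. cinner x (e j) *\<^sub>C complex_of_real (sv j) *\<^sub>C e j))) \<longlonglongrightarrow> R x - 0"
    by (intro tendsto_diff tendsto_const)
  then show ?thesis by simp
qed

lemma abs_operator_eq: "abs_operator A = diag_op sv e e"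
  unfolding abs_operator_def
proof (rule the_equality)
  let ?D = "diag_op sv e e"
  have pos: "positive_operator ?D"
    by (intro positive_operator_diag_op diagonal_sv orthonormal_right sv_nonneg)
  then show "positive_operator ?D \<and> ?D \<circ> ?D = cadjoint A \<circ> A" using abs_root by blast
  fix R assume "positive_operator R \<and> R \<circ> R = cadjoint A \<circ> A"
  then show "R = ?D"
    using positive_root_tendsto[of R] positive_root_tendsto[OF pos abs_root]
    by (intro ext) (auto intro: LIMSEQ_unique)
qed

end

section \<open>Null sequences are determined by their level counts\<close>

lemma finite_c0_star_level:
  assumes "s \<in> c0_star" "0 < r"
  shows "finite {n. s n = r}"
proof -
  have "s \<longlonglongrightarrow> 0" using assms(1) by (simp add: c0_star_def)
  then obtain N where "\<And>n. n \<ge> N \<Longrightarrow> s n < r"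
    using order_tendstoD(2)[of s 0 sequentially r] assms(2) by (auto simp: eventually_sequentially)
  then have "n < N" if "s n = r" for n using that by (metis less_irrefl not_le)
  then have "{n. s n = r} \<subseteq> {..<N}" by auto
  then show ?thesis by (rule finite_subset) simp
qed

text \<open>At the first index \<open>N\<close> of disagreement, say \<open>s N < t N\<close>. Then
  \<open>s\<close> takes the value \<open>t N\<close> only before \<open>N\<close>, where
  \<open>t\<close> agrees with it, while \<open>t\<close> takes it once more at \<open>N\<close>;
  the levels are finite, so the counts differ. The local fact \<open>less\<close> is stated for
  arbitrary sequences so that it serves both orders.\<close>

lemma c0_star_eqI:
  assumes s: "s \<in> c0_star" and t: "t \<in> c0_star"
    and card: "\<And>r. 0 < r \<Longrightarrow> card {n. s n = r} = card {n. t n = r}"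
  shows "s = t"
proof (rule ccontr)
  have less: False if s: "s \<in> c0_star" and t: "t \<in> c0_star" and N: "\<And>n. n < N \<Longrightarrow> s n = t n"
    and "s N < t N" and card: "\<And>r. 0 < r \<Longrightarrow> card {n. s n = r} = card {n. t n = r}" for s t N
  proof -
    have r: "t N > 0" using s \<open>s N < t N\<close> by (auto simp: c0_star_def intro: le_less_trans)
    have "s n \<noteq> t N" if "n \<ge> N" for n
      using s that \<open>s N < t N\<close> by (fastforce simp: c0_star_def dest: decseqD)
    then have "n < N \<and> t n = t N" if "s n = t N" for n using that N by (metis not_le)
    then have "{n. s n = t N} \<subseteq> {n. t n = t N} - {N}" by auto
    moreover have "finite {n. t n = t N}" using finite_c0_star_level[OF t r] .
    moreover have "{n. t n = t N} - {N} \<subset> {n. t n = t N}" by auto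
    ultimately have "card {n. s n = t N} < card {n. t n = t N}"
      by (meson psubset_card_mono subset_psubset_trans)
    then show False using card[OF r] by simp
  qed
  assume "s \<noteq> t"
  then obtain n where "s n \<noteq> t n" by auto
  define N where "N = (LEAST n. s n \<noteq> t n)"
  have "s N \<noteq> t N" unfolding N_def using \<open>s n \<noteq> t n\<close> by (rule LeastI)
  moreover have "s n = t n" if "n < N" for n using not_less_Least that unfolding N_def by blast
  ultimately show False
    using less[OF s t, of N] less[OF t s, of N] card by (auto simp: linorder_neq_iff)
qed

context schmidt
begin

text \<open>Padding occurs only at the value 0, so a positive level set indexes nonzero orthonormal
  vectors and its cardinality is the dimension of their span.\<close>

lemma singular_values_eq: "singular_values A = sv"
  unfolding singular_values_def
proof (rule the_equality)
  have card: "card {n. sv n = r} = complex_vector.dim (eigenspace (abs_operator A) (complex_of_real r))"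
    if "r > 0" for r
  proof -
    have "eigenspace (abs_operator A) (complex_of_real r) = complex_vector.span (e ` {j. sv j = r})"
      unfolding abs_operator_eq using that right_nonzero finite_c0_star_level[OF sv_c0_star that]
      by (intro eigenspace_diag_op diagonal_sv orthonormal_right) auto
    then show ?thesis
      using dim_span_orthonormal[OF orthonormal_right, of "{j. sv j = r}"] right_nonzero that by auto
  qed
  then show "sv \<in> c0_star \<and> (\<forall>r>0. card {n. sv n = r} =
      complex_vector.dim (eigenspace (abs_operator A) (complex_of_real r)))"
    using sv_c0_star by blast
  fix s assume "s \<in> c0_star \<and> (\<forall>r>0. card {n. s n = r} =
      complex_vector.dim (eigenspace (abs_operator A) (complex_of_real r)))"
  then show "s = sv" using card sv_c0_star by (intro c0_star_eqI) auto
qed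

end

section \<open>Block decompositions\<close>

lemma compact_closureI:
  fixes S :: "'a::complete_space set"
  assumes "\<And>\<epsilon>. 0 < \<epsilon> \<Longrightarrow> \<exists>K. finite K \<and> S \<subseteq> (\<Union>x\<in>K. ball x \<epsilon>)"
  shows "compact (closure S)"
  unfolding compact_eq_totally_bounded
proof (intro conjI allI impI)
  show "complete (closure S)" by (simp add: complete_eq_closed)
  fix \<epsilon> :: real assume "0 < \<epsilon>"
  from assms[OF half_gt_zero[OF this]]
  obtain K where K: "finite K" "S \<subseteq> (\<Union>x\<in>K. ball x (\<epsilon> / 2))" by (elim exE conjE)
  have "S \<subseteq> (\<Union>x\<in>K. cball x (\<epsilon> / 2))" 
    by (rule order_trans[OF K(2)]) (intro UN_mono ball_subset_cball order_refl)
  then have "closure S \<subseteq> (\<Union>x\<in>K. cball x (\<epsilon> / 2))"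
    using K(1) by (intro closure_minimal closed_UN) auto
  also have "\<dots> \<subseteq> (\<Union>x\<in>K. ball x \<epsilon>)" using \<open>0 < \<epsilon>\<close> by (intro UN_mono) auto
  finally show "\<exists>K. finite K \<and> closure S \<subseteq> (\<Union>x\<in>K. ball x \<epsilon>)" using K(1) by blast
qed

lemma compact_finite_sums:
  fixes S :: "'i \<Rightarrow> 'a::real_normed_vector set"
  assumes "finite F" "\<And>i. i \<in> F \<Longrightarrow> compact (S i)"
  shows "\<exists>C. compact C \<and> (\<forall>z. (\<forall>i\<in>F. z i \<in> S i) \<longrightarrow> sum z F \<in> C)"
  using assms
proof (induction F)
  case empty
  show ?case by (rule exI[of _ "{0}"]) simp
next
  case (insert i F)
  then obtain C where C: "compact C" "\<And>z. \<forall>i\<in>F. z i \<in> S i \<Longrightarrow> sum z F \<in> C" by auto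
  have "compact {x + y |x y. x \<in> S i \<and> y \<in> C}" using insert.prems C(1) by (intro compact_sums) auto
  moreover have "sum z (insert i F) \<in> {x + y |x y. x \<in> S i \<and> y \<in> C}"
    if "\<forall>j\<in>insert i F. z j \<in> S j" for z
    using that C(2)[of z] insert.hyps by auto
  ultimately show ?case by blast
qed

lemma orthogonal_projectionD:
  assumes "orthogonal_projection P"
  shows "bounded_clinear P" "P (P x) = P x" "cinner (P x) y = cinner x (P y)" "norm (P x) \<le> norm x"
proof -
  show 1: "bounded_clinear P" "P (P x) = P x" "cinner (P x) y = cinner x (P y)" for x y
    using assms by (auto simp: orthogonal_projection_def dest: fun_cong)
  have "cinner (P x) (P x) = cinner (P x) x" using 1(2,3) by metis
  then have "(norm (P x))\<^sup>2 = inner (P x) x" by (metis Re_cinner power2_norm_eq_inner)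
  also have "\<dots> \<le> norm (P x) * norm x" by (rule norm_cauchy_schwarz)
  finally show "norm (P x) \<le> norm x"
    by (cases "P x = 0") (auto simp: power2_eq_square)
qed

locale block =
  fixes P :: "int \<Rightarrow> 'a::chilbert_space \<Rightarrow> 'a"
  assumes P: "block_decomposition P"
begin

lemma proj: "orthogonal_projection (P n)"
  using P by (simp add: block_decomposition_def)

lemmas projD = orthogonal_projectionD[OF proj]

lemma linear: "bounded_linear (P n)"
  using projD(1) by (rule bounded_clinearD)

lemma cinner_orth: "m \<noteq> n \<Longrightarrow> cinner (P m x) (P n y) = 0"
proof -
  assume "m \<noteq> n"
  then have "P m \<circ> P n = (\<lambda>x. 0)" using P by (simp add: block_decomposition_def)
  then have "P m (P n y) = 0" by (metis comp_apply)
  then show ?thesis by (simp add: projD(3))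
qed

lemma bessel: "finite F \<Longrightarrow> (\<Sum>n\<in>F. (norm (P n x))\<^sup>2) \<le> (norm x)\<^sup>2"
proof -
  assume F: "finite F"
  let ?p = "\<Sum>n\<in>F. P n x"
  have eq: "(norm ?p)\<^sup>2 = (\<Sum>n\<in>F. (norm (P n x))\<^sup>2)"
    using F by (intro norm_sum_Pythagorean) (auto simp: pairwise_def intro!: orthogonal_cinner cinner_orth)
  have "(norm (P n x))\<^sup>2 = inner (P n x) x" for n
  proof -
    have "cinner (P n x) (P n x) = cinner (P n x) x" using projD(2,3) by metis
    then show ?thesis by (metis Re_cinner power2_norm_eq_inner)
  qed
  then have "(norm ?p)\<^sup>2 = inner ?p x" by (simp add: eq inner_sum_left)
  also have "\<dots> \<le> norm ?p * norm x" by (rule norm_cauchy_schwarz)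
  finally have "norm ?p \<le> norm x" by (cases "?p = 0") (auto simp: power2_eq_square)
  then show ?thesis unfolding eq[symmetric] by (intro power_mono) auto
qed

lemma bessel_shift: "finite F \<Longrightarrow> (\<Sum>n\<in>F. (norm (P (n + k) x))\<^sup>2) \<le> (norm x)\<^sup>2"
  using bessel[of "(\<lambda>n. n + k) ` F" x] by (simp add: sum.reindex)

lemma finite_large:
  assumes "0 < \<delta>"
  shows "finite {n. \<delta> \<le> norm (P n x)}"
proof (rule ccontr)
  obtain N where N: "(norm x)\<^sup>2 < real N * \<delta>\<^sup>2"
    using ex_less_of_nat_mult[of "\<delta>\<^sup>2" "(norm x)\<^sup>2"] assms by auto
  assume "infinite {n. \<delta> \<le> norm (P n x)}"
  then obtain F where F: "finite F" "card F = N" "F \<subseteq> {n. \<delta> \<le> norm (P n x)}"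
    using infinite_arbitrarily_large by blast
  have "real N * \<delta>\<^sup>2 = (\<Sum>n\<in>F. \<delta>\<^sup>2)" using F(2) by simp
  also have "\<dots> \<le> (\<Sum>n\<in>F. (norm (P n x))\<^sup>2)"
    using F(3) assms by (intro sum_mono power_mono) auto
  also have "\<dots> \<le> (norm x)\<^sup>2" by (rule bessel[OF F(1)])
  finally show False using N by simp
qed

text \<open>Cover the image of the unit ball by finitely many balls of radius
  \<open>\<epsilon> / 2\<close>. Each centre has only finitely many large blocks, and outside their
  union every block is small on the whole image. The bound holds for each \<open>n\<close>
  separately; orthogonality of the blocks later makes this enough for their sum.\<close>

lemma compact_operator_tail:
  assumes T: "compact_operator T" and "0 < \<epsilon>"
  shows "\<exists>F. finite F \<and> (\<forall>n. n \<notin> F \<longrightarrow> (\<forall>z. norm (P n (T z)) \<le> \<epsilon> * norm z))"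
proof -
  interpret T: bounded_linear T using T by (rule compact_operatorD)
  obtain K where K: "finite K" "closure (T ` cball 0 1) \<subseteq> (\<Union>y\<in>K. ball y (\<epsilon> / 2))"
    using compact_operatorD(3)[OF T] \<open>0 < \<epsilon>\<close> unfolding compact_eq_totally_bounded
    by (meson half_gt_zero)
  define F where "F = (\<Union>y\<in>K. {n. \<epsilon> / 2 \<le> norm (P n y)})"
  have "finite F" unfolding F_def using \<open>0 < \<epsilon>\<close> by (intro finite_UN_I K(1) finite_large) simp
  moreover have "norm (P n (T z)) \<le> \<epsilon> * norm z" if n: "n \<notin> F" for n z
  proof (cases "z = 0")
    case True
    then show ?thesis by (simp add: T.zero linear_0[OF bounded_linear.linear[OF linear]])
  next
    case False
    interpret Pn: bounded_linear "P n" by (rule linear)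
    define w where "w = (1 / norm z) *\<^sub>R z"
    have "T w \<in> closure (T ` cball 0 1)"
      using False by (intro subsetD[OF closure_subset] imageI) (simp add: w_def)
    then obtain y where y: "y \<in> K" "norm (T w - y) < \<epsilon> / 2"
      using K(2) by (auto simp: dist_norm norm_minus_commute)
    have "P n (T w) = P n y + P n (T w - y)" by (simp add: Pn.diff)
    then have "norm (P n (T w)) \<le> norm (P n y) + norm (P n (T w - y))"
      using norm_triangle_ineq by metis
    also have "norm (P n (T w - y)) \<le> norm (T w - y)" by (rule projD)
    also have "norm (P n y) < \<epsilon> / 2" using n y(1) by (auto simp: F_def not_le)
    finally have "norm (P n (T w)) \<le> \<epsilon>" using y(2) by simp
    then show ?thesis using False by (simp add: w_def T.scaleR Pn.scaleR field_simps)
  qed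
  ultimately show ?thesis by blast
qed

end

section \<open>Strong convergence and compactness of the shifted operator\<close>

locale block_pair = P: block P + Q: block Q
  for P Q :: "int \<Rightarrow> 'a::chilbert_space \<Rightarrow> 'a" +
  fixes k :: int
begin

text \<open>Pythagoras for the ranges of \<open>Q n\<close> combined with Bessel for the
  \<open>P (n + k)\<close>. Arbitrary \<open>A\<close> and \<open>B\<close> allow two uses: the full
  series with an operator bound for \<open>T\<close>, and the tail outside a finite set with a small
  \<open>B\<close>.\<close>

lemma
  assumes le: "\<And>n. n \<in> A \<Longrightarrow> norm (Q n (z n)) \<le> B * norm (P (n + k) x)" and B: "0 \<le> B"
  shows summable_blocks: "(\<lambda>n. Q n (z n)) summable_on A"
    and norm_infsum_blocks_le: "norm (\<Sum>\<^sub>\<infinity>n\<in>A. Q n (z n)) \<le> B * norm x"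
proof -
  have orth: "pairwise (\<lambda>i j. orthogonal (Q i (z i)) (Q j (z j))) A"
    by (auto simp: pairwise_def intro!: orthogonal_cinner Q.cinner_orth)
  have sq: "(\<Sum>n\<in>F. (norm (Q n (z n)))\<^sup>2) \<le> (B * norm x)\<^sup>2" if F: "finite F" "F \<subseteq> A" for F
  proof -
    have "(\<Sum>n\<in>F. (norm (Q n (z n)))\<^sup>2) \<le> (\<Sum>n\<in>F. (B * norm (P (n + k) x))\<^sup>2)"
      using le F by (intro sum_mono power_mono) auto
    also have "\<dots> = B\<^sup>2 * (\<Sum>n\<in>F. (norm (P (n + k) x))\<^sup>2)"
      by (simp add: sum_distrib_left power_mult_distrib)
    also have "\<dots> \<le> B\<^sup>2 * (norm x)\<^sup>2" by (intro mult_left_mono P.bessel_shift F) simp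
    finally show ?thesis by (simp add: power_mult_distrib)
  qed
  show "(\<lambda>n. Q n (z n)) summable_on A"
    by (rule summable_on_orthogonal_bounded[OF orth sq]) (use B in auto)
  show "norm (\<Sum>\<^sub>\<infinity>n\<in>A. Q n (z n)) \<le> B * norm x"
    by (rule norm_infsum_orthogonal_le[OF orth sq]) (use B in auto)
qed

lemma
  assumes T: "bounded_clinear T"
  shows summable_shift: "(\<lambda>n. Q n (T (P (n + k) x))) summable_on A"
    and bounded_clinear_shift: "bounded_clinear (asymmetric_shift Q P T k)"
proof -
  interpret T: bounded_linear T using T by (rule bounded_clinearD)
  obtain K where K: "0 \<le> K" "\<And>x. norm (T x) \<le> norm x * K" using T.nonneg_bounded by blast
  have le: "norm (Q n (T (P (n + k) x))) \<le> K * norm (P (n + k) x)" for n x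
    using Q.projD(4)[of n "T (P (n + k) x)"] K(2)[of "P (n + k) x"] by (simp add: mult.commute)
  show sum: "(\<lambda>n. Q n (T (P (n + k) x))) summable_on A" for x A
    by (rule summable_blocks[OF le K(1)])
  let ?S = "asymmetric_shift Q P T k"
  note lin = bounded_linear.linear[OF P.linear] bounded_linear.linear[OF Q.linear] T.linear
  have "?S (x + y) = ?S x + ?S y" for x y
    using infsum_add[OF sum[of x UNIV] sum[of y UNIV]]
    by (simp add: asymmetric_shift_def linear_add[OF lin(1)] linear_add[OF lin(2)] T.add)
  moreover have scale: "?S (c *\<^sub>C x) = c *\<^sub>C ?S x" for c x
    using infsumI[OF has_sum_bounded_linear[OF bounded_linear_scaleC_right has_sum_infsum[OF sum[of x UNIV]]], of c]
    by (simp add: asymmetric_shift_def bounded_clinearD(2)[OF T] bounded_clinearD(2)[OF P.projD(1)]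
        bounded_clinearD(2)[OF Q.projD(1)])
  moreover have "norm (?S x) \<le> norm x * K" for x
    unfolding asymmetric_shift_def using norm_infsum_blocks_le[where A = UNIV and x = x, OF le K(1)]
    by (simp add: mult.commute)
  moreover have "?S (r *\<^sub>R x) = r *\<^sub>R ?S x" for r x
    using scale[of "complex_of_real r" x] by (simp add: scaleC_of_real)
  ultimately show "bounded_clinear ?S"
    unfolding bounded_clinear_def by (blast intro: bounded_linear_intro)
qed

text \<open>On the unit ball the operator stays within \<open>\<epsilon> / 2\<close> of a finite
  block sum whose values lie in a compact set, so a finite \<open>\<epsilon> / 2\<close>-net of that
  set is an \<open>\<epsilon>\<close>-net of the image.\<close>

lemma compact_operator_shift:
  assumes T: "compact_operator T"
  shows "compact_operator (asymmetric_shift Q P T k)"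
  unfolding compact_operator_def
proof (intro conjI bounded_clinear_shift compact_closureI)
  show Tl: "bounded_clinear T" using T by (rule compact_operatorD)
  let ?S = "asymmetric_shift Q P T k"
  let ?t = "\<lambda>x n. Q n (T (P (n + k) x))"
  fix \<epsilon> :: real assume \<epsilon>: "0 < \<epsilon>"
  obtain F where F: "finite F" "\<And>n z. n \<notin> F \<Longrightarrow> norm (Q n (T z)) \<le> (\<epsilon> / 2) * norm z"
    using Q.compact_operator_tail[OF T, of "\<epsilon> / 2"] \<epsilon> by auto
  have "compact (Q n ` closure (T ` cball 0 1))" for n
    by (intro compact_continuous_image linear_continuous_on Q.linear compact_operatorD(3)[OF T])
  from compact_finite_sums[where S = "\<lambda>n. Q n ` closure (T ` cball 0 1)", OF F(1) this]
  obtain C where C: "compact C"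
    "\<And>z. \<forall>n\<in>F. z n \<in> Q n ` closure (T ` cball 0 1) \<Longrightarrow> sum z F \<in> C" by metis
  obtain K where K: "finite K" "C \<subseteq> (\<Union>y\<in>K. ball y (\<epsilon> / 2))"
    using C(1) \<epsilon> unfolding compact_eq_totally_bounded by (meson half_gt_zero)
  have "?S x \<in> (\<Union>y\<in>K. ball y \<epsilon>)" if x: "norm x \<le> 1" for x
  proof -
    have "?t x n \<in> Q n ` closure (T ` cball 0 1)" for n
      using P.projD(4)[of "n + k" x] x
      by (intro imageI subsetD[OF closure_subset]) simp
    then have "sum (?t x) F \<in> C" by (intro C(2)) simp
    then obtain y where y: "y \<in> K" "dist y (sum (?t x) F) < \<epsilon> / 2" using K(2) by auto
    have "?S x = (\<Sum>\<^sub>\<infinity>n\<in>F. ?t x n) + (\<Sum>\<^sub>\<infinity>n\<in>- F. ?t x n)"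
      unfolding asymmetric_shift_def
      using infsum_Un_disjoint[OF summable_shift[OF Tl] summable_shift[OF Tl], of F "- F" x]
      by simp
    then have "?S x - sum (?t x) F = (\<Sum>\<^sub>\<infinity>n\<in>- F. ?t x n)" using F(1) by simp
    moreover have "norm (\<Sum>\<^sub>\<infinity>n\<in>- F. ?t x n) \<le> (\<epsilon> / 2) * norm x"
      using F(2) \<epsilon> by (intro norm_infsum_blocks_le) auto
    moreover have "(\<epsilon> / 2) * norm x \<le> \<epsilon> / 2" using x \<epsilon> by (simp add: mult_left_le)
    ultimately have "dist (sum (?t x) F) (?S x) \<le> \<epsilon> / 2" by (simp add: dist_norm norm_minus_commute)
    then have "dist y (?S x) < \<epsilon>" using y(2) dist_triangle[of y "?S x" "sum (?t x) F"] by simp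
    then show ?thesis using y(1) by auto
  qed
  then show "\<exists>K. finite K \<and> ?S ` cball 0 1 \<subseteq> (\<Union>x\<in>K. ball x \<epsilon>)"
    using K(1) by (intro exI[of _ K]) auto
qed

end

section \<open>Ky Fan's inequality for the shifted operator\<close>

text \<open>Unit weights on the first \<open>m\<close> indices are optimal. Subtracting the
  threshold \<open>s m\<close> makes the coefficients nonnegative before \<open>m\<close> and
  nonpositive from \<open>m\<close> on; the amount subtracted is paid for by the bound on the total
  weight.\<close>

lemma sum_mult_decseq_le:
  fixes s c :: "nat \<Rightarrow> real"
  assumes s: "decseq s" "\<And>j. 0 \<le> s j"
    and c: "\<And>j. 0 \<le> c j" "\<And>j. c j \<le> 1" "(\<Sum>j<J. c j) \<le> real m"
  shows "(\<Sum>j<J. s j * c j) \<le> (\<Sum>j<m. s j)"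
proof -
  have "(s j - s m) * c j \<le> (if j \<in> {..<m} then s j - s m else 0)" for j
    using decseqD[OF s(1), of j m] decseqD[OF s(1), of m j] c(1,2)[of j]
    by (auto simp: mult_left_le mult_nonpos_nonneg)
  then have "(\<Sum>j<J. (s j - s m) * c j) \<le> (\<Sum>j<J. if j \<in> {..<m} then s j - s m else 0)"
    by (intro sum_mono)
  also have "\<dots> = (\<Sum>j\<in>{..<J} \<inter> {..<m}. s j - s m)" by (simp add: sum.inter_restrict)
  also have "\<dots> \<le> (\<Sum>j<m. s j - s m)"
    using decseqD[OF s(1)] by (intro sum_mono2) auto
  also have "\<dots> = (\<Sum>j<m. s j) - s m * real m" by (simp add: sum_subtractf mult.commute)
  finally have "(\<Sum>j<J. s j * c j) - s m * (\<Sum>j<J. c j) \<le> (\<Sum>j<m. s j) - s m * real m"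
    by (simp add: algebra_simps sum_subtractf sum_distrib_left)
  moreover have "s m * (\<Sum>j<J. c j) \<le> s m * real m" using c(3) s(2) by (intro mult_left_mono)
  ultimately show ?thesis by simp
qed

lemma mult_le_mean_squares: "a * b \<le> (a\<^sup>2 + b\<^sup>2) / 2" for a b :: real
  using zero_le_power2[of "a - b"] by (simp add: power2_diff)

lemma (in schmidt) cinner_apply_le:
  "cmod (cinner (A x) y) \<le>
    (\<Sum>j<J. sv j * (cmod (cinner x (e j)) * cmod (cinner (left j) y))) + sv J * (norm x * norm y)"
proof -
  let ?p = "\<Sum>j<J. cinner x (e j) *\<^sub>C A (e j)"
  have "cinner (A x) y = cinner ?p y + cinner (A x - ?p) y" by (simp add: cinner_diff_left)
  then have "cmod (cinner (A x) y) \<le> cmod (cinner ?p y) + cmod (cinner (A x - ?p) y)"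
    using norm_triangle_ineq by metis
  also have "cmod (cinner ?p y) \<le> (\<Sum>j<J. sv j * (cmod (cinner x (e j)) * cmod (cinner (left j) y)))"
    unfolding cinner_sum_left sv_left cinner_scaleC_left
    by (rule order_trans[OF norm_sum]) (simp add: norm_mult sv_nonneg mult_ac)
  also have "cmod (cinner (A x - ?p) y) \<le> norm (A x - ?p) * norm y" by (rule norm_cinner_le)
  also have "\<dots> \<le> sv J * norm x * norm y" by (intro mult_right_mono remainder_le) simp
  finally show ?thesis by (simp add: mult_ac)
qed

lemma (in block_pair) sum_cinner_shift_le:
  assumes T: "schmidt T e" and u: "orthonormal_or_zero u" and v: "orthonormal_or_zero v"
    and F: "finite F"
  shows "(\<Sum>i<m. \<Sum>n\<in>F. cmod (cinner (T (P (n + k) (u i))) (Q n (v i)))) \<le> (\<Sum>j<m. schmidt.sv T e j)"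
proof -
  interpret T: schmidt T e by fact
  define a where "a i n j = cmod (cinner (P (n + k) (u i)) (e j))" for i :: nat and n j
  define b where "b i n j = cmod (cinner (T.left j) (Q n (v i)))" for i :: nat and n j
  define c where "c j = (\<Sum>i<m. \<Sum>n\<in>F. a i n j * b i n j)" for j
  have Pu: "(\<Sum>n\<in>F. (norm (P (n + k) (u i)))\<^sup>2) \<le> 1" for i
    using P.bessel_shift[OF F, of k "u i"] power_le_one[OF norm_ge_zero orthonormal_or_zeroD(3)[OF u], of i 2]
    by linarith
  have Qv: "(\<Sum>n\<in>F. (norm (Q n (v i)))\<^sup>2) \<le> 1" for i
    using Q.bessel[OF F, of "v i"] power_le_one[OF norm_ge_zero orthonormal_or_zeroD(3)[OF v], of i 2]
    by linarith
  have mean: "(\<Sum>n\<in>F. ((norm (P (n + k) (u i)))\<^sup>2 + (norm (Q n (v i)))\<^sup>2) / 2) \<le> 1" for i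
    using Pu[of i] Qv[of i] by (simp add: sum.distrib flip: sum_divide_distrib)
  \<comment> \<open>This sum multiplies \<open>T.sv J\<close> in the error made by cutting the
    Schmidt series after \<open>J\<close> terms.\<close>
  have norms: "(\<Sum>i<m. \<Sum>n\<in>F. norm (P (n + k) (u i)) * norm (Q n (v i))) \<le> real m"
  proof -
    have "(\<Sum>n\<in>F. norm (P (n + k) (u i)) * norm (Q n (v i))) \<le> 1" for i
      by (rule order_trans[OF sum_mono mean[of i]]) (rule mult_le_mean_squares)
    then show ?thesis using sum_mono[of "{..<m}" _ "\<lambda>_. 1::real"] by fastforce
  qed
  have c0: "0 \<le> c j" for j by (auto simp: c_def a_def b_def intro!: sum_nonneg)
  \<comment> \<open>Self-adjointness moves the projections onto \<open>e j\<close> and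
    \<open>T.left j\<close>. The sum over \<open>i\<close> is taken first, by Bessel for
    \<open>u\<close> and \<open>v\<close>, and the sum over the blocks is then Bessel for the
    decompositions.\<close>
  have c1: "c j \<le> 1" for j
  proof -
    have ua: "(\<Sum>i<m. \<Sum>n\<in>F. (a i n j)\<^sup>2) \<le> 1"
    proof -
      have "(\<Sum>i<m. \<Sum>n\<in>F. (a i n j)\<^sup>2) = (\<Sum>n\<in>F. \<Sum>i<m. (a i n j)\<^sup>2)" by (rule sum.swap)
      also have "\<dots> = (\<Sum>n\<in>F. \<Sum>i<m. (cmod (cinner (P (n + k) (e j)) (u i)))\<^sup>2)"
        by (simp add: a_def P.projD(3) norm_cinner_commute[of "u _"])
      also have "\<dots> \<le> (\<Sum>n\<in>F. (norm (P (n + k) (e j)))\<^sup>2)"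
        by (intro sum_mono bessel_inequality[OF u]) simp
      also have "\<dots> \<le> (norm (e j))\<^sup>2" by (rule P.bessel_shift[OF F])
      also have "\<dots> \<le> 1" by (intro power_le_one orthonormal_or_zeroD(3)[OF T.orthonormal_right]) simp
      finally show ?thesis .
    qed
    have vb: "(\<Sum>i<m. \<Sum>n\<in>F. (b i n j)\<^sup>2) \<le> 1"
    proof -
      have "(\<Sum>i<m. \<Sum>n\<in>F. (b i n j)\<^sup>2) = (\<Sum>n\<in>F. \<Sum>i<m. (b i n j)\<^sup>2)" by (rule sum.swap)
      also have "\<dots> = (\<Sum>n\<in>F. \<Sum>i<m. (cmod (cinner (Q n (T.left j)) (v i)))\<^sup>2)"
        by (simp add: b_def Q.projD(3))
      also have "\<dots> \<le> (\<Sum>n\<in>F. (norm (Q n (T.left j)))\<^sup>2)"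
        by (intro sum_mono bessel_inequality[OF v]) simp
      also have "\<dots> \<le> (norm (T.left j))\<^sup>2" by (rule Q.bessel[OF F])
      also have "\<dots> \<le> 1" by (intro power_le_one orthonormal_or_zeroD(3)[OF T.orthonormal_left]) simp
      finally show ?thesis .
    qed
    have "c j \<le> (\<Sum>i<m. \<Sum>n\<in>F. ((a i n j)\<^sup>2 + (b i n j)\<^sup>2) / 2)"
      unfolding c_def by (intro sum_mono mult_le_mean_squares)
    also have "\<dots> \<le> 1" using ua vb by (simp add: sum.distrib flip: sum_divide_distrib)
    finally show ?thesis .
  qed
  \<comment> \<open>Now the projections stay on \<open>u i\<close> and \<open>v i\<close>, and the
    sum over \<open>j\<close> is taken first for each \<open>i\<close> and \<open>n\<close>; summing
    the blocks contributes at most 1 for each \<open>i\<close>.\<close>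
  have cm: "(\<Sum>j<J. c j) \<le> real m" for J
  proof -
    have ab: "(\<Sum>j<J. a i n j * b i n j) \<le> ((norm (P (n + k) (u i)))\<^sup>2 + (norm (Q n (v i)))\<^sup>2) / 2" for i n
    proof -
      have "(\<Sum>j<J. a i n j * b i n j) \<le> (\<Sum>j<J. ((a i n j)\<^sup>2 + (b i n j)\<^sup>2) / 2)"
        by (intro sum_mono mult_le_mean_squares)
      also have "\<dots> = ((\<Sum>j<J. (a i n j)\<^sup>2) + (\<Sum>j<J. (b i n j)\<^sup>2)) / 2"
        by (simp add: sum.distrib flip: sum_divide_distrib)
      also have "\<dots> \<le> ((norm (P (n + k) (u i)))\<^sup>2 + (norm (Q n (v i)))\<^sup>2) / 2"
        using bessel_inequality[OF T.orthonormal_right, of "{..<J}" "P (n + k) (u i)"]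
          bessel_inequality[OF T.orthonormal_left, of "{..<J}" "Q n (v i)"]
        by (simp add: a_def b_def norm_cinner_commute[of "T.left _"])
      finally show ?thesis .
    qed
    have "(\<Sum>j<J. c j) = (\<Sum>i<m. \<Sum>n\<in>F. \<Sum>j<J. a i n j * b i n j)"
      unfolding c_def by (simp only: sum.swap[of _ "{..<J}"])
    also have "\<dots> \<le> (\<Sum>i<m. 1)"
      by (intro sum_mono order_trans[OF sum_mono mean]) (rule ab)
    finally show ?thesis by simp
  qed
  have "(\<Sum>i<m. \<Sum>n\<in>F. cmod (cinner (T (P (n + k) (u i))) (Q n (v i)))) \<le> (\<Sum>j<m. T.sv j) + T.sv J * real m"
    for J
  proof -
    have "(\<Sum>i<m. \<Sum>n\<in>F. cmod (cinner (T (P (n + k) (u i))) (Q n (v i)))) \<le>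
      (\<Sum>i<m. \<Sum>n\<in>F. (\<Sum>j<J. T.sv j * (a i n j * b i n j)) + T.sv J * (norm (P (n + k) (u i)) * norm (Q n (v i))))"
      unfolding a_def b_def by (intro sum_mono T.cinner_apply_le)
    also have "\<dots> = (\<Sum>i<m. \<Sum>n\<in>F. \<Sum>j<J. T.sv j * (a i n j * b i n j)) +
        T.sv J * (\<Sum>i<m. \<Sum>n\<in>F. norm (P (n + k) (u i)) * norm (Q n (v i)))"
      by (simp add: sum.distrib sum_distrib_left)
    also have "(\<Sum>i<m. \<Sum>n\<in>F. \<Sum>j<J. T.sv j * (a i n j * b i n j)) = (\<Sum>j<J. T.sv j * c j)"
      unfolding c_def sum_distrib_left by (simp only: sum.swap[of _ "{..<J}"])
    also have "\<dots> \<le> (\<Sum>j<m. T.sv j)"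
      using T.sv_c0_star c0 c1 cm by (intro sum_mult_decseq_le) (auto simp: c0_star_def)
    also have "T.sv J * (\<Sum>i<m. \<Sum>n\<in>F. norm (P (n + k) (u i)) * norm (Q n (v i))) \<le> T.sv J * real m"
      by (intro mult_left_mono norms T.sv_nonneg)
    finally show ?thesis by simp
  qed
  moreover have "(\<lambda>J. (\<Sum>j<m. T.sv j) + T.sv J * real m) \<longlonglongrightarrow> (\<Sum>j<m. T.sv j) + 0 * real m"
    by (intro tendsto_intros T.sv_tendsto)
  ultimately show ?thesis by (intro LIMSEQ_le_const[where X = "\<lambda>J. (\<Sum>j<m. T.sv j) + T.sv J * real m"]) auto
qed

lemma schmidtI:
  fixes A :: "'a::chilbert_space \<Rightarrow> 'a"
  assumes "compact_operator A"
  obtains e where "schmidt A e"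
  using exists_schmidt_system[OF assms] compact_operatorD(1)[OF assms] by (auto simp: schmidt_def)

lemma (in block_pair) submajorized_shift:
  assumes T: "compact_operator T"
  shows "singular_values (asymmetric_shift Q P T k) \<prec>\<prec> singular_values T"
proof -
  let ?S = "asymmetric_shift Q P T k"
  obtain e u where "schmidt T e" "schmidt ?S u"
    using schmidtI T compact_operator_shift[OF T] by metis
  interpret T: schmidt T e by fact
  interpret S: schmidt ?S u by fact
  \<comment> \<open>The block contributions to the \<open>i\<close>-th singular value of
    \<open>?S\<close>. Real inner products suffice, since pairing \<open>?S (u i)\<close> with
    \<open>S.left i\<close> gives its norm.\<close>
  let ?g = "\<lambda>i n. inner (Q n (T (P (n + k) (u i)))) (S.left i)"
  have "(?g i has_sum S.sv i) UNIV" for i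
  proof -
    have "((\<lambda>n. Q n (T (P (n + k) (u i)))) has_sum ?S (u i)) UNIV"
      unfolding asymmetric_shift_def by (intro has_sum_infsum summable_shift T.A)
    from has_sum_bounded_linear[OF bounded_linear_inner_left this]
    have "(?g i has_sum inner (?S (u i)) (S.left i)) UNIV" .
    also have "inner (?S (u i)) (S.left i) = S.sv i"
      by (cases "?S (u i) = 0")
        (simp_all add: S.sv_def S.left_def sgn_div_norm power2_eq_square flip: power2_norm_eq_inner)
    finally show ?thesis .
  qed
  then have sum: "((\<lambda>n. \<Sum>i<m. ?g i n) has_sum (\<Sum>i<m. S.sv i)) UNIV" for m
    by (induction m) (auto intro: has_sum_add)
  have "(\<Sum>i<m. S.sv i) \<le> (\<Sum>j<m. T.sv j)" for m
  \<comment> \<open>The bound is uniform in the finite set of blocks, so it passes to the full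
    series.\<close>
  proof (rule has_sum_le_finite_sums[OF sum])
    fix F :: "int set" assume F: "finite F"
    have "(\<Sum>n\<in>F. \<Sum>i<m. ?g i n) = (\<Sum>i<m. \<Sum>n\<in>F. ?g i n)" by (rule sum.swap)
    also have "\<dots> \<le> (\<Sum>i<m. \<Sum>n\<in>F. cmod (cinner (T (P (n + k) (u i))) (Q n (S.left i))))"
      by (intro sum_mono) (simp add: complex_Re_le_cmod flip: Re_cinner Q.projD(3))
    also have "\<dots> \<le> (\<Sum>j<m. T.sv j)"
      by (rule sum_cinner_shift_le[OF T.schmidt_axioms S.orthonormal_right S.orthonormal_left F])
    finally show "(\<Sum>n\<in>F. \<Sum>i<m. ?g i n) \<le> (\<Sum>j<m. T.sv j)" .
  qed
  then show ?thesis
    by (simp add: submajorized_def T.singular_values_eq S.singular_values_eq)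
qed

theorem theorem8:
  fixes P Q :: "int \<Rightarrow> 'a::chilbert_space \<Rightarrow> 'a"
    and T :: "'a \<Rightarrow> 'a"
  assumes "block_decomposition P"
    and "block_decomposition Q"
    and "compact_operator T"
  shows "(\<forall>k x. (\<lambda>n. Q n (T (P (n + k) x))) summable_on UNIV) \<and>
    (\<forall>k. singular_values (asymmetric_shift Q P T k) \<prec>\<prec> singular_values T) \<and>
    (\<forall>I. operator_ideal I \<and> T \<in> I \<longrightarrow> (\<forall>k. asymmetric_shift Q P T k \<in> am_closure I))"
proof -
  interpret block_pair P Q k for k
    using assms by unfold_locales
  show ?thesis
    \<comment> \<open>\<open>T\<close> itself is the element of \<open>I\<close> that witnesses
      membership in \<open>am_closure I\<close>.\<close>
    using summable_shift[OF compact_operatorD(1)] submajorized_shift compact_operator_shift assms(3)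
    by (auto simp: am_closure_def)
qed

end
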